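(* Let $C$ be a finite chain, $m\ge1$, and let $K$ be a subgroup of $S_m$ generated by powers of pairwise disjoint cycles, acting on $C^m$ by permuting coordinates: $\phi\cdot(c_1,\dots,c_m)=(c_{\phi^{-1}(1)},\dots,c_{\phi^{-1}(m)})$. Then the quotient poset $C^m/K$ is a symmetric chain order.
   Context: $C^m$ carries the coordinatewise (product) order. For a poset $P$ and a group $K$ of automorphisms of $P$, the quotient $P/K$ is the set of $K$-orbits $[x]$, ordered by $[x]\le[y]$ iff $x'\le y'$ for some $x'\in[x]$, $y'\in[y]$. A finite poset is ranked if it has a minimum and all saturated chains from the minimum to any $x$ have the same length $r(x)$; a chain $x_1<\dots<x_k$ is symmetric if it is saturated and $r(x_1)+r(x_k)=\max_x r(x)$; a symmetric chain order is a ranked poset that can be partitioned into symmetric chains. *)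

theory Defs
  imports "HOL-Library.FuncSet" "HOL-Combinatorics.Cycles"
begin

definition poset_on :: "'b set \<Rightarrow> ('b \<Rightarrow> 'b \<Rightarrow> bool) \<Rightarrow> bool" where
  "poset_on P le \<longleftrightarrow> (\<forall>x\<in>P. le x x)
     \<and> (\<forall>x\<in>P. \<forall>y\<in>P. le x y \<and> le y x \<longrightarrow> x = y)
     \<and> (\<forall>x\<in>P. \<forall>y\<in>P. \<forall>z\<in>P. le x y \<and> le y z \<longrightarrow> le x z)"

definition covers :: "'b set \<Rightarrow> ('b \<Rightarrow> 'b \<Rightarrow> bool) \<Rightarrow> 'b \<Rightarrow> 'b \<Rightarrow> bool" where
  "covers P le x y \<longleftrightarrow> x \<in> P \<and> y \<in> P \<and> le x y \<and> x \<noteq> y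
     \<and> \<not> (\<exists>z\<in>P. le x z \<and> le z y \<and> z \<noteq> x \<and> z \<noteq> y)"

definition saturated_chain :: "'b set \<Rightarrow> ('b \<Rightarrow> 'b \<Rightarrow> bool) \<Rightarrow> 'b list \<Rightarrow> bool" where
  "saturated_chain P le xs \<longleftrightarrow> xs \<noteq> [] \<and> set xs \<subseteq> P
     \<and> (\<forall>i. Suc i < length xs \<longrightarrow> covers P le (xs ! i) (xs ! Suc i))"

definition is_minimum :: "'b set \<Rightarrow> ('b \<Rightarrow> 'b \<Rightarrow> bool) \<Rightarrow> 'b \<Rightarrow> bool" where
  "is_minimum P le b \<longleftrightarrow> b \<in> P \<and> (\<forall>x\<in>P. le b x)"

definition ranked :: "'b set \<Rightarrow> ('b \<Rightarrow> 'b \<Rightarrow> bool) \<Rightarrow> bool" where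
  "ranked P le \<longleftrightarrow> finite P \<and> (\<exists>b. is_minimum P le b \<and>
     (\<forall>x\<in>P. \<forall>xs ys.
        saturated_chain P le xs \<and> hd xs = b \<and> last xs = x \<and>
        saturated_chain P le ys \<and> hd ys = b \<and> last ys = x \<longrightarrow> length xs = length ys))"

definition rank :: "'b set \<Rightarrow> ('b \<Rightarrow> 'b \<Rightarrow> bool) \<Rightarrow> 'b \<Rightarrow> nat" where
  "rank P le x = (THE k. \<exists>xs. saturated_chain P le xs \<and> hd xs = (THE b. is_minimum P le b)
                       \<and> last xs = x \<and> length xs = Suc k)"

definition symmetric_chain :: "'b set \<Rightarrow> ('b \<Rightarrow> 'b \<Rightarrow> bool) \<Rightarrow> 'b list \<Rightarrow> bool" where
  "symmetric_chain P le xs \<longleftrightarrow> saturated_chain P le xs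
     \<and> rank P le (hd xs) + rank P le (last xs) = Max (rank P le ` P)"

definition symmetric_chain_order :: "'b set \<Rightarrow> ('b \<Rightarrow> 'b \<Rightarrow> bool) \<Rightarrow> bool" where
  "symmetric_chain_order P le \<longleftrightarrow> poset_on P le \<and> ranked P le \<and>
     (\<exists>\<C>. (\<forall>xs\<in>\<C>. symmetric_chain P le xs)
         \<and> (\<forall>xs\<in>\<C>. \<forall>ys\<in>\<C>. xs \<noteq> ys \<longrightarrow> set xs \<inter> set ys = {})
         \<and> (\<Union>xs\<in>\<C>. set xs) = P)"

inductive_set gen_perm_group :: "('c \<Rightarrow> 'c) set \<Rightarrow> ('c \<Rightarrow> 'c) set" for S where
  gen_id: "id \<in> gen_perm_group S"
| gen_mult: "s \<in> S \<Longrightarrow> g \<in> gen_perm_group S \<Longrightarrow> s \<circ> g \<in> gen_perm_group S"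
| gen_inv: "s \<in> S \<Longrightarrow> g \<in> gen_perm_group S \<Longrightarrow> inv s \<circ> g \<in> gen_perm_group S"

definition cube :: "'a set \<Rightarrow> nat \<Rightarrow> (nat \<Rightarrow> 'a) set" where
  "cube C m = ({0..<m} \<rightarrow>\<^sub>E C)"

definition perm_act :: "nat \<Rightarrow> (nat \<Rightarrow> nat) \<Rightarrow> (nat \<Rightarrow> 'a) \<Rightarrow> (nat \<Rightarrow> 'a)" where
  "perm_act m \<phi> c = restrict (\<lambda>i. c (inv \<phi> i)) {0..<m}"

definition orbit_of :: "nat \<Rightarrow> (nat \<Rightarrow> nat) set \<Rightarrow> (nat \<Rightarrow> 'a) \<Rightarrow> (nat \<Rightarrow> 'a) set" where
  "orbit_of m K c = (\<lambda>\<phi>. perm_act m \<phi> c) ` K"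

definition quotient_cube :: "'a set \<Rightarrow> nat \<Rightarrow> (nat \<Rightarrow> nat) set \<Rightarrow> (nat \<Rightarrow> 'a) set set" where
  "quotient_cube C m K = orbit_of m K ` cube C m"

definition quotient_le :: "nat \<Rightarrow> (nat \<Rightarrow> 'a::order) set \<Rightarrow> (nat \<Rightarrow> 'a) set \<Rightarrow> bool" where
  "quotient_le m A B \<longleftrightarrow> (\<exists>x\<in>A. \<exists>y\<in>B. \<forall>i<m. x i \<le> y i)"

end

theory Submission
  imports Defs
begin

text \<open>The group is a product of cyclic groups acting on disjoint sets of coordinates, and products of
  symmetric chain orders are symmetric chain orders, so one power of one cycle is enough. A tuple on
  a cycle of length \<open>n\<close> over a chain with \<open>c + 1\<close> elements becomes a cyclic 0/1-word of length \<open>c n\<close>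
  (a unary code of length \<open>c\<close> for each entry), on which the group acts by rotations.

  Match brackets cyclically, with 0 opening and 1 closing. A word of at most half the length in ones
  has unmatched positions only among its zeros. Turning the unmatched zero at the end of a widest
  gap between consecutive unmatched zeros into a one creates an arc that is strictly longer than all
  others, so that the old word can be read off the new one, without any choice that a rotation could
  disturb. This defines a partial map between consecutive ranks of the lower half of the quotient
  that covers each class below the middle, whence chains reaching the middle. Turning all unmatched
  zeros into ones commutes with rotations and reflects these chains into the upper half.\<close>

section \<open>Symmetric chain decompositions of quasi-orders\<close>

text \<open>On a line, the Greene-Kleitman rule turns the leftmost unmatched zero into a one. A
  circle has no leftmost position, and picking one would not be compatible with rotations; the shape
  of the word itself has to point to the position. Uniqueness is needed only backwards: chains in
  the lower half are disjoint as soon as a raised word determines its predecessor up to rotation.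
  This needs at least two unmatched zeros per period, so that a gap is shorter than the period;
  their number is the surplus of zeros over ones, hence at least 2 exactly when the next rank is
  still in the lower half. The reflection fits because raising a word never creates unmatched zeros,
  so filling reverses the order along each chain. The unary code adds an obstacle of its own: only
  words whose blocks have their ones first stand for tuples, and both operations must stay within
  them. Quotients are postponed to the very end. Until then tuples and words carry quasi-orders,
  which makes products and changes of coding plain statements about functions. Words live on all
  integers and are periodic, so that arcs need no modular arithmetic.\<close>

text \<open>The relation \<open>le\<close> is only a quasi-order: it stands for the poset of its equivalence classes. The
  fibres of the labelling \<open>L\<close> are the symmetric chains, and \<open>s\<close> gives the bottom rank of a chain.\<close>

definition scd_labelling ::
  "'x set \<Rightarrow> ('x \<Rightarrow> 'x \<Rightarrow> bool) \<Rightarrow> ('x \<Rightarrow> nat) \<Rightarrow> nat \<Rightarrow> ('x \<Rightarrow> 'l) \<Rightarrow> ('l \<Rightarrow> nat) \<Rightarrow> bool" where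
  "scd_labelling X le r N L s \<longleftrightarrow>
     (\<forall>x\<in>X. s (L x) \<le> r x \<and> r x + s (L x) \<le> N \<and>
        (\<forall>k. s (L x) \<le> k \<and> k + s (L x) \<le> N \<longrightarrow> (\<exists>y\<in>X. L y = L x \<and> r y = k))) \<and>
     (\<forall>x\<in>X. \<forall>y\<in>X. le x y \<and> le y x \<longrightarrow> L x = L y \<and> r x = r y) \<and>
     (\<forall>x\<in>X. \<forall>y\<in>X. L x = L y \<and> r x \<le> r y \<longrightarrow> le x y)"

text \<open>A definition cannot quantify over a type of labels. Sets of elements are enough, since
  every label can be replaced by its fibre; \<open>has_scdI\<close> does this.\<close>

definition has_scd :: "'x set \<Rightarrow> ('x \<Rightarrow> 'x \<Rightarrow> bool) \<Rightarrow> ('x \<Rightarrow> nat) \<Rightarrow> nat \<Rightarrow> bool" where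
  "has_scd X le r N \<longleftrightarrow> (\<exists>(L :: 'x \<Rightarrow> 'x set) s. scd_labelling X le r N L s)"

lemma scd_labelling_bounds:
  assumes "scd_labelling X le r N L s" "x \<in> X"
  shows "s (L x) \<le> r x" "r x + s (L x) \<le> N"
  using assms unfolding scd_labelling_def by blast+

lemma scd_labelling_fill:
  assumes "scd_labelling X le r N L s" "x \<in> X" "s (L x) \<le> k" "k + s (L x) \<le> N"
  obtains y where "y \<in> X" "L y = L x" "r y = k"
  using assms unfolding scd_labelling_def by blast

lemma scd_labelling_cong:
  assumes "scd_labelling X le r N L s" "x \<in> X" "y \<in> X" "le x y" "le y x"
  shows "L x = L y" "r x = r y"
  using assms unfolding scd_labelling_def by blast+

lemma scd_labelling_le:
  assumes "scd_labelling X le r N L s" "x \<in> X" "y \<in> X" "L x = L y" "r x \<le> r y"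
  shows "le x y"
  using assms unfolding scd_labelling_def by blast

lemma has_scdI:
  fixes L :: "'x \<Rightarrow> 'l"
  assumes "scd_labelling X le r N L s"
  shows "has_scd X le r N"
proof -
  define F where "F l = {y\<in>X. L y = l}" for l
  have F: "F (L x) = F (L y) \<longleftrightarrow> L x = L y" if "x \<in> X" "y \<in> X" for x y
    using that by (auto simp: F_def)
  define s' where "s' A = s (L (SOME x. x \<in> A))" for A
  have s': "s' (F (L x)) = s (L x)" if "x \<in> X" for x
  proof -
    have "x \<in> F (L x)" using that by (simp add: F_def)
    then have "(SOME y. y \<in> F (L x)) \<in> F (L x)" by (rule someI)
    then show ?thesis by (simp add: s'_def F_def)
  qed
  have "scd_labelling X le r N (\<lambda>x. F (L x)) s'"
    unfolding scd_labelling_def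
  proof (intro conjI ballI allI impI; (elim conjE)?)
    fix x k assume x: "x \<in> X" and "s' (F (L x)) \<le> k" "k + s' (F (L x)) \<le> N"
    then obtain y where "y \<in> X" "L y = L x" "r y = k"
      using scd_labelling_fill[OF assms x] s'[OF x] by metis
    then show "\<exists>y\<in>X. F (L y) = F (L x) \<and> r y = k" by (intro bexI[of _ y]) auto
  next
    fix x y assume "x \<in> X" "y \<in> X" "F (L x) = F (L y)" "r x \<le> r y"
    then show "le x y" using scd_labelling_le[OF assms] F by blast
  next
    fix x y assume "x \<in> X" "y \<in> X" "le x y" "le y x"
    then have "L x = L y" "r x = r y" by (fact scd_labelling_cong[OF assms])+
    then show "F (L x) = F (L y)" "r x = r y" by simp_all
  qed (simp_all add: s' scd_labelling_bounds[OF assms])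
  then show ?thesis unfolding has_scd_def by blast
qed

text \<open>\<open>fill\<close> only has to cover the ranks between \<open>r x\<close> and its
  mirror image \<open>N - r x\<close>. Applied to an element of lowest rank in a fibre, this gives
  the whole symmetric interval, so the bottom ranks need not be supplied.\<close>

lemma has_scd_intervalI:
  fixes L :: "'x \<Rightarrow> 'l"
  assumes bound: "\<And>x. x \<in> X \<Longrightarrow> r x \<le> N"
    and inv: "\<And>x y. x \<in> X \<Longrightarrow> y \<in> X \<Longrightarrow> le x y \<Longrightarrow> le y x \<Longrightarrow> L x = L y \<and> r x = r y"
    and chain: "\<And>x y. x \<in> X \<Longrightarrow> y \<in> X \<Longrightarrow> L x = L y \<Longrightarrow> r x \<le> r y \<Longrightarrow> le x y"
    and fill: "\<And>x k. x \<in> X \<Longrightarrow> min (r x) (N - r x) \<le> k \<Longrightarrow> k \<le> max (r x) (N - r x)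
                  \<Longrightarrow> \<exists>y\<in>X. L y = L x \<and> r y = k"
  shows "has_scd X le r N"
proof -
  define s where "s l = (LEAST k. \<exists>x\<in>X. L x = l \<and> r x = k)" for l
  have s: "s (L x) \<le> r x \<and> r x + s (L x) \<le> N \<and>
        (\<forall>k. s (L x) \<le> k \<and> k + s (L x) \<le> N \<longrightarrow> (\<exists>y\<in>X. L y = L x \<and> r y = k))"
    if x: "x \<in> X" for x
  proof -
    have least: "s (L x) \<le> r y" if "y \<in> X" "L y = L x" for y
      unfolding s_def by (rule Least_le) (use that in auto)
    have "\<exists>y\<in>X. L y = L x \<and> r y = s (L x)"
      unfolding s_def by (rule LeastI[where k = "r x"]) (use x in auto)
    then obtain y where y: "y \<in> X" "L y = L x" "r y = s (L x)" by blast
    obtain z where z: "z \<in> X" "L z = L x" "r z = N - r x"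
      using fill[OF x, of "N - r x"] by auto
    have 1: "s (L x) \<le> N - r x" using least[OF z(1,2)] z(3) by simp
    have 2: "\<exists>y'\<in>X. L y' = L x \<and> r y' = k" if "s (L x) \<le> k" "k + s (L x) \<le> N" for k
      using fill[OF y(1), of k] that y by auto
    show ?thesis using least[OF x] bound[OF x] 1 2 by auto
  qed
  have "scd_labelling X le r N L s"
    unfolding scd_labelling_def using s inv chain by blast
  then show ?thesis by (rule has_scdI)
qed

lemma has_scd_singleton:
  assumes "X = {a}" "r a = 0" "le a a"
  shows "has_scd X le r 0"
  by (rule has_scd_intervalI[where L = "\<lambda>_. ()"]) (use assms in auto)

lemma has_scd_pullback:
  fixes X :: "'x set" and Y :: "'y set"
  assumes "has_scd Y le' r' N"
    and "f ` X = Y"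
    and "\<And>x y. x \<in> X \<Longrightarrow> y \<in> X \<Longrightarrow> le x y \<longleftrightarrow> le' (f x) (f y)"
    and "\<And>x. x \<in> X \<Longrightarrow> r x = r' (f x)"
  shows "has_scd X le r N"
proof -
  obtain L :: "'y \<Rightarrow> 'y set" and s where l: "scd_labelling Y le' r' N L s"
    using assms(1) unfolding has_scd_def by blast
  have f: "f x \<in> Y" if "x \<in> X" for x using assms(2) that by blast
  have "scd_labelling X le r N (\<lambda>x. L (f x)) s"
    unfolding scd_labelling_def
  proof (intro conjI ballI allI impI; (elim conjE)?)
    fix x k assume x: "x \<in> X" and "s (L (f x)) \<le> k" "k + s (L (f x)) \<le> N"
    then obtain y where "y \<in> Y" "L y = L (f x)" "r' y = k"
      using scd_labelling_fill[OF l f] by metis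
    moreover from this(1) obtain y' where "y' \<in> X" "y = f y'" using assms(2) by blast
    ultimately show "\<exists>y\<in>X. L (f y) = L (f x) \<and> r y = k" using assms(4) by auto
  next
    fix x y assume xy: "x \<in> X" "y \<in> X" and "le x y" "le y x"
    then have "le' (f x) (f y)" "le' (f y) (f x)" using assms(3) by auto
    from scd_labelling_cong[OF l f[OF xy(1)] f[OF xy(2)] this]
    show "L (f x) = L (f y)" "r x = r y" using assms(4) xy by auto
  qed (use assms(3,4) scd_labelling_bounds[OF l f] scd_labelling_le[OF l f f] in simp_all)
  then show ?thesis by (rule has_scdI)
qed

text \<open>On one leg of a hook \<open>i\<close> is constant, on the other \<open>c - j\<close> is;
  so moving up in total rank moves up weakly in both coordinates.\<close>

lemma hook_mono:
  fixes i j c :: nat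
  assumes "min i (c - j) = min i' (c - j')" "j \<le> c" "j' \<le> c" "i + j \<le> i' + j'"
  shows "i \<le> i' \<and> j \<le> j'"
  using assms by (auto simp: min_def split: if_splits)

text \<open>The two cases are the two legs: up to total rank \<open>b\<close> the first coordinate
  stays at \<open>d\<close>, beyond that the second stays at \<open>b - d\<close>.\<close>

lemma hook_fill:
  fixes a b d k :: nat
  assumes "d \<le> a" "d \<le> b" "d \<le> k" "k + d \<le> a + b"
  shows "\<exists>i j. i + j = k \<and> i \<le> a \<and> j \<le> b \<and> min i (b - j) = d"
proof (cases "k \<le> b")
  case True
  then show ?thesis using assms by (intro exI[of _ d] exI[of _ "k - d"]) auto
next
  case False
  then show ?thesis using assms by (intro exI[of _ "k + d - b"] exI[of _ "b - d"]) auto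
qed

text \<open>Two chains of ranks \<open>0..a\<close> and \<open>0..b\<close> have their product split into the hooks
  \<open>min i (b - j) = k\<close>, which run from \<open>(k, 0)\<close> via \<open>(k, b - k)\<close> to \<open>(a, b - k)\<close>.\<close>

lemma has_scd_prod:
  fixes X :: "'a set" and Y :: "'b set"
  assumes "has_scd X le1 r1 M" "has_scd Y le2 r2 N"
  shows "has_scd (X \<times> Y) (\<lambda>(x, y) (x', y'). le1 x x' \<and> le2 y y') (\<lambda>(x, y). r1 x + r2 y) (M + N)"
proof -
  obtain L1 :: "'a \<Rightarrow> 'a set" and s1 where l1: "scd_labelling X le1 r1 M L1 s1"
    using assms(1) unfolding has_scd_def by blast
  obtain L2 :: "'b \<Rightarrow> 'b set" and s2 where l2: "scd_labelling Y le2 r2 N L2 s2"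
    using assms(2) unfolding has_scd_def by blast
  define h where "h x y = min (r1 x - s1 (L1 x)) (N - s2 (L2 y) - r2 y)" for x y
  show ?thesis
  proof (rule has_scd_intervalI[where L = "\<lambda>(x, y). (L1 x, L2 y, h x y)"], goal_cases)
    case (1 p)
    then show ?case
      using scd_labelling_bounds(2)[OF l1]
        scd_labelling_bounds(2)[OF l2] by fastforce
  next
    case (2 p q)
    then obtain x y x' y' where pq: "p = (x, y)" "q = (x', y')" by fastforce
    with 2 scd_labelling_cong[OF l1, of x x'] scd_labelling_cong[OF l2, of y y']
    show ?case by (simp add: h_def)
  next
    case (3 p q)
    obtain x y x' y' where pq: "p = (x, y)" "q = (x', y')" by fastforce
    with 3 have L: "L1 x = L1 x'" "L2 y = L2 y'" "h x y = h x' y'"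
      and in_XY: "x \<in> X" "y \<in> Y" "x' \<in> X" "y' \<in> Y"
      and le: "r1 x + r2 y \<le> r1 x' + r2 y'" by auto
    have b: "s1 (L1 x) \<le> r1 x" "s1 (L1 x) \<le> r1 x'" "r2 y + s2 (L2 y) \<le> N" "r2 y' + s2 (L2 y) \<le> N"
      using scd_labelling_bounds(1)[OF l1 in_XY(1)] scd_labelling_bounds(1)[OF l1 in_XY(3)]
        scd_labelling_bounds(2)[OF l2 in_XY(2)] scd_labelling_bounds(2)[OF l2 in_XY(4)] L(1,2)
      by simp_all
    have "r1 x - s1 (L1 x) \<le> r1 x' - s1 (L1 x) \<and> r2 y \<le> r2 y'"
      by (rule hook_mono[where c = "N - s2 (L2 y)"])
        (use b le L(3) in \<open>simp_all add: h_def flip: L(1,2)\<close>)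
    then have "r1 x \<le> r1 x'" "r2 y \<le> r2 y'" using b by auto
    then have "le1 x x'" "le2 y y'"
      using scd_labelling_le[OF l1] scd_labelling_le[OF l2] in_XY L by auto
    then show ?case using pq by simp
  next
    case (4 p k)
    obtain x y where p: "p = (x, y)" "x \<in> X" "y \<in> Y" using 4(1) by auto
    let ?s = "s1 (L1 x)" and ?t = "s2 (L2 y)"
    have b: "?s \<le> r1 x" "r1 x + ?s \<le> M" "?t \<le> r2 y" "r2 y + ?t \<le> N"
      using scd_labelling_bounds[OF l1 p(2)] scd_labelling_bounds[OF l2 p(3)] by auto
    \<comment> \<open>After subtracting the bottom ranks, the two chains have ranks
      \<open>0..a\<close> and \<open>0..b\<close>. The hook through \<open>(i0, j0)\<close> then
      covers the ranks from \<open>d\<close> to \<open>a + b - d\<close>, an interval that is closed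
      under taking mirror images.\<close>
    define d where "d = h x y"
    define i0 where "i0 = r1 x - ?s"
    define j0 where "j0 = r2 y - ?t"
    define a where "a = M - 2 * ?s"
    define b where "b = N - 2 * ?t"
    have r: "r1 x = i0 + ?s" "r2 y = j0 + ?t" "M = a + 2 * ?s" "N = b + 2 * ?t" "i0 \<le> a" "j0 \<le> b"
      using b by (auto simp: i0_def j0_def a_def b_def)
    have d: "d = min i0 (b - j0)" by (simp add: d_def h_def r)
    have "d \<le> a" "d \<le> b" "d \<le> i0" "d + j0 \<le> b" using d r(5,6) by auto
    moreover have "i0 + j0 + ?s + ?t \<le> k \<and> k \<le> a + b + ?s + ?t - (i0 + j0)
        \<or> a + b + ?s + ?t - (i0 + j0) \<le> k \<and> k \<le> i0 + j0 + ?s + ?t"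
      using 4(2,3) r unfolding p by (auto simp: min_def max_def split: if_splits)
    ultimately have "d + (?s + ?t) \<le> k" "k + d \<le> a + b + (?s + ?t)" using r(5,6) by linarith+
    then have k': "k = (k - (?s + ?t)) + (?s + ?t)" "d \<le> k - (?s + ?t)" "(k - (?s + ?t)) + d \<le> a + b"
      by simp_all
    obtain i j where ij0: "i + j = k - (?s + ?t)" "i \<le> a" "j \<le> b" "min i (b - j) = d"
      using hook_fill[OF \<open>d \<le> a\<close> \<open>d \<le> b\<close> k'(2,3)] by blast
    have ij: "?s \<le> i + ?s" "i + ?s + ?s \<le> M" "?t \<le> j + ?t" "j + ?t + ?t \<le> N"
      using ij0 r by simp_all
    obtain x' where x': "x' \<in> X" "L1 x' = L1 x" "r1 x' = i + ?s"
      by (rule scd_labelling_fill[OF l1 p(2) ij(1,2)])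
    obtain y' where y': "y' \<in> Y" "L2 y' = L2 y" "r2 y' = j + ?t"
      by (rule scd_labelling_fill[OF l2 p(3) ij(3,4)])
    have "h x' y' = h x y" using x' y' ij0(4) r(4) d_def by (simp add: h_def)
    then show ?case
      using x' y' ij0(1) k'(1)[symmetric] p by (intro bexI[of _ "(x', y')"]) auto
  qed
qed

text \<open>\<open>R x y\<close> raises the rank by one in the lower half and \<open>y\<close>
  determines \<open>x\<close>, so any choice of successors partitions the lower half into chains that all reach
  the middle, and a chain can be labelled by its middle element. The map \<open>T\<close> reflects these chains into the upper half.\<close>

lemma has_scd_reflect:
  fixes X :: "'x set" and N :: nat
  assumes refl: "\<And>x. x \<in> X \<Longrightarrow> le x x"
    and trans: "\<And>x y z. x \<in> X \<Longrightarrow> y \<in> X \<Longrightarrow> z \<in> X \<Longrightarrow> le x y \<Longrightarrow> le y z \<Longrightarrow> le x z"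
    and mono: "\<And>x y. x \<in> X \<Longrightarrow> y \<in> X \<Longrightarrow> le x y \<Longrightarrow> r x \<le> r y"
    and eq: "\<And>x y. x \<in> X \<Longrightarrow> y \<in> X \<Longrightarrow> le x y \<Longrightarrow> r x = r y \<Longrightarrow> le y x"
    and bound: "\<And>x. x \<in> X \<Longrightarrow> r x \<le> N"
    and R_ex: "\<And>x. x \<in> X \<Longrightarrow> 2 * r x + 2 \<le> N \<Longrightarrow> \<exists>y\<in>X. R x y"
    and R_up: "\<And>x y. x \<in> X \<Longrightarrow> y \<in> X \<Longrightarrow> 2 * r x + 2 \<le> N \<Longrightarrow> R x y
                 \<Longrightarrow> r y = Suc (r x) \<and> le x y \<and> le (T y) (T x)"
    and R_inj: "\<And>x y x' y'. x \<in> X \<Longrightarrow> y \<in> X \<Longrightarrow> x' \<in> X \<Longrightarrow> y' \<in> X \<Longrightarrow> 2 * r x + 2 \<le> N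
                 \<Longrightarrow> 2 * r x' + 2 \<le> N \<Longrightarrow> R x y \<Longrightarrow> R x' y' \<Longrightarrow> le y y' \<Longrightarrow> le y' y \<Longrightarrow> le x x'"
    and T_in: "\<And>x. x \<in> X \<Longrightarrow> 2 * r x \<le> N \<Longrightarrow> T x \<in> X \<and> r (T x) = N - r x \<and> le x (T x)"
    and T_le: "\<And>x y. x \<in> X \<Longrightarrow> y \<in> X \<Longrightarrow> 2 * r x \<le> N \<Longrightarrow> le x y \<Longrightarrow> le y x \<Longrightarrow> le (T x) (T y)"
    and T_inj: "\<And>x y. x \<in> X \<Longrightarrow> y \<in> X \<Longrightarrow> 2 * r x \<le> N \<Longrightarrow> 2 * r y \<le> N \<Longrightarrow> le (T x) (T y)
                 \<Longrightarrow> le (T y) (T x) \<Longrightarrow> le x y"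
    and T_surj: "\<And>z. z \<in> X \<Longrightarrow> N < 2 * r z \<Longrightarrow> \<exists>x\<in>X. 2 * r x \<le> N \<and> T x = z"
  shows "has_scd X le r N"
proof -
  define eqv where "eqv x y \<longleftrightarrow> x \<in> X \<and> y \<in> X \<and> le x y \<and> le y x" for x y
  have eqv_in: "x \<in> X" "y \<in> X" if "eqv x y" for x y using that by (simp_all add: eqv_def)
  have eqv_refl: "eqv x x" if "x \<in> X" for x using that refl by (simp add: eqv_def)
  have eqv_sym: "eqv y x" if "eqv x y" for x y using that by (simp add: eqv_def)
  have eqv_trans: "eqv x z" if "eqv x y" "eqv y z" for x y z
    using that trans unfolding eqv_def by blast
  have eqv_r: "r x = r y" if "eqv x y" for x y
    using that mono by (auto simp: eqv_def intro: antisym)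
  have eqv_le: "le x y" "le y x" if "eqv x y" for x y using that by (simp_all add: eqv_def)
  \<comment> \<open>The choice is made among the raises of all elements equivalent to
    \<open>x\<close>, so that \<open>up\<close> takes equal and not merely equivalent values on
    equivalent elements (\<open>up_cong\<close>).\<close>
  define up where "up x = (SOME y. y \<in> X \<and> (\<exists>x'. eqv x' x \<and> R x' y))" for x
  define low where "low x \<longleftrightarrow> x \<in> X \<and> 2 * r x + 2 \<le> N" for x
  have up: "up x \<in> X \<and> (\<exists>x'. eqv x' x \<and> R x' (up x))" if l: "low x" for x
  proof -
    have "\<exists>y. y \<in> X \<and> (\<exists>x'. eqv x' x \<and> R x' y)" using R_ex l eqv_refl unfolding low_def by blast
    then show ?thesis unfolding up_def by (rule someI_ex)
  qed
  have up_in: "up x \<in> X" and up_r: "r (up x) = Suc (r x)" and up_le: "le x (up x)"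
    and up_T: "le (T (up x)) (T x)" if l: "low x" for x
  proof -
    obtain x' where x': "up x \<in> X" "eqv x' x" "R x' (up x)" using up[OF l] by blast
    have r: "r x' = r x" and x: "x \<in> X" and x'X: "x' \<in> X"
      using eqv_r[OF x'(2)] eqv_in[OF x'(2)] by auto
    have b: "2 * r x' + 2 \<le> N" using l r by (simp add: low_def)
    note * = R_up[OF x'X x'(1) b x'(3)]
    show "up x \<in> X" by fact
    show "r (up x) = Suc (r x)" using * r by simp
    show "le x (up x)" using trans[OF x x'X x'(1)] eqv_le[OF x'(2)] * by blast
    have "le (T x') (T x)" using T_le[OF x'X x _ eqv_le[OF x'(2)]] b by simp
    then show "le (T (up x)) (T x)"
      using trans[of "T (up x)" "T x'" "T x"] T_in[OF x] T_in[OF x'X] T_in[OF x'(1)] * b r by auto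
  qed
  have up_cong: "up x = up y" if "eqv x y" for x y
  proof -
    have "eqv x' x \<longleftrightarrow> eqv x' y" for x' using that eqv_sym eqv_trans by blast
    then show ?thesis by (simp add: up_def)
  qed
  have up_inj: "eqv x y" if l: "low x" "low y" and e: "eqv (up x) (up y)" for x y
  proof -
    obtain x' y' where x': "eqv x' x" "R x' (up x)" and y': "eqv y' y" "R y' (up y)"
      using up l by blast
    have b: "2 * r x' + 2 \<le> N" "2 * r y' + 2 \<le> N"
      using eqv_r[OF x'(1)] eqv_r[OF y'(1)] l by (simp_all add: low_def)
    note X = eqv_in(1)[OF x'(1)] up_in[OF l(1)] eqv_in(1)[OF y'(1)] up_in[OF l(2)]
    have "le x' y'" by (rule R_inj[OF X(1-4) b x'(2) y'(2) eqv_le[OF e]])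
    moreover have "le y' x'"
      by (rule R_inj[OF X(3,4,1,2) b(2,1) y'(2) x'(2) eqv_le(2,1)[OF e]])
    ultimately have "eqv x' y'" using X by (simp add: eqv_def)
    then show ?thesis using x' y' eqv_sym eqv_trans by blast
  qed
  have it: "(up ^^ k) x \<in> X \<and> r ((up ^^ k) x) = r x + k \<and> le x ((up ^^ k) x)
      \<and> le (T ((up ^^ k) x)) (T x)" if "x \<in> X" "2 * (r x + k) \<le> N" for x k
    using that(2)
  proof (induction k)
    case 0
    then show ?case using that(1) T_in refl by simp
  next
    case (Suc k)
    then have IH: "(up ^^ k) x \<in> X" "r ((up ^^ k) x) = r x + k" "le x ((up ^^ k) x)"
      "le (T ((up ^^ k) x)) (T x)" by auto
    have l: "low ((up ^^ k) x)" using IH Suc.prems by (simp add: low_def)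
    note u = up_in[OF l] up_r[OF l] up_le[OF l] up_T[OF l]
    have "le x (up ((up ^^ k) x))" using trans[OF that(1) IH(1) u(1) IH(3) u(3)] .
    moreover have "le (T (up ((up ^^ k) x))) (T x)"
      using trans[OF _ _ _ u(4) IH(4)] T_in u(1,2) IH(1,2) that(1) Suc.prems by auto
    ultimately show ?case using u IH by simp
  qed
  have it_inj: "eqv x y" if "x \<in> X" "y \<in> X" "2 * (r x + k) \<le> N" "r x = r y"
      "eqv ((up ^^ k) x) ((up ^^ k) y)" for x y k
    using that(3,5)
  proof (induction k)
    case (Suc k)
    have "low ((up ^^ k) x)" "low ((up ^^ k) y)"
      using it[OF that(1), of k] it[OF that(2), of k] that(4) Suc.prems(1) by (auto simp: low_def)
    then show ?case using Suc up_inj by simp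
  qed simp
  \<comment> \<open>For odd \<open>N\<close> the middle ranks are \<open>M\<close> and
    \<open>M + 1\<close>, and \<open>T\<close> joins them; for even \<open>N\<close> it maps rank
    \<open>M\<close> to rank \<open>M\<close>.\<close>
  define M where "M = N div 2"
  have M: "2 * k \<le> N \<longleftrightarrow> k \<le> M" for k by (auto simp: M_def)
  define top where "top x = (up ^^ (M - r x)) x" for x
  \<comment> \<open>An upper element receives the label of its preimage under \<open>T\<close>,
    which is unique up to equivalence by \<open>T_inj\<close>.\<close>
  define bot where "bot z = (if 2 * r z \<le> N then z else (SOME x. x \<in> X \<and> 2 * r x \<le> N \<and> T x = z))" for z
  have bot: "bot z \<in> X \<and> r (bot z) \<le> M" if "z \<in> X" for z
  proof (cases "2 * r z \<le> N")
    case True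
    then show ?thesis using that M by (simp add: bot_def)
  next
    case False
    then have "\<exists>x. x \<in> X \<and> 2 * r x \<le> N \<and> T x = z" using T_surj[OF that] by auto
    from someI_ex[OF this] show ?thesis using False M by (simp add: bot_def)
  qed
  have bot_lower: "bot z = z" if "r z \<le> M" for z using that M by (simp add: bot_def)
  have bot_upper: "T (bot z) = z" if "z \<in> X" "M < r z" for z
  proof -
    have *: "\<not> 2 * r z \<le> N" using that M by auto
    then have "\<exists>x. x \<in> X \<and> 2 * r x \<le> N \<and> T x = z" using T_surj[OF that(1)] by auto
    from someI_ex[OF this] show ?thesis using * by (simp add: bot_def)
  qed
  have top_in: "top x \<in> X" if "x \<in> X" "r x \<le> M" for x
    using it[OF that(1), of "M - r x"] that(2) M by (simp add: top_def)
  have top_cong: "eqv (top x) (top y)" if "eqv x y" "r x \<le> M" for x y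
  proof (cases "M - r x")
    case 0
    then show ?thesis using that eqv_r[OF that(1)] by (simp add: top_def)
  next
    case (Suc k)
    then have "top x = (up ^^ k) (up x)" "top y = (up ^^ k) (up x)"
      using eqv_r[OF that(1)] up_cong[OF that(1)] by (simp_all add: top_def funpow_swap1)
    then show ?thesis using top_in[OF eqv_in(1)[OF that(1)] that(2)] eqv_refl by simp
  qed
  \<comment> \<open>Lifting \<open>x\<close> by \<open>up\<close> to the rank of \<open>y\<close>
    does not change its top, so by \<open>it_inj\<close> the result is equivalent to
    \<open>y\<close>.\<close>
  have chain: "le x y \<and> le (T y) (T x)"
    if xy: "x \<in> X" "y \<in> X" "r x \<le> r y" "r y \<le> M" and t: "eqv (top x) (top y)" for x y
  proof -
    define k where "k = r y - r x"
    have rk: "r x + k = r y" using xy(3) by (simp add: k_def)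
    then have "2 * (r x + k) \<le> N" using xy(4) M[of "r y"] by simp
    note i = it[OF xy(1) this, unfolded rk]
    note i = i[THEN conjunct1] i[THEN conjunct2, THEN conjunct1]
      i[THEN conjunct2, THEN conjunct2, THEN conjunct1] i[THEN conjunct2, THEN conjunct2, THEN conjunct2]
    have Mk: "M - r x = (M - r y) + k" using rk xy(4) by linarith
    have "top x = (up ^^ (M - r y)) ((up ^^ k) x)"
      unfolding top_def Mk by (simp only: funpow_add comp_apply)
    then have e: "eqv ((up ^^ k) x) y"
      using it_inj[OF i(1) xy(2), of "M - r y"] i(2) t xy(4) M by (simp add: top_def)
    have "le (T y) (T ((up ^^ k) x))"
      using T_le[OF xy(2) i(1)] eqv_le[OF e] xy(4) M by simp
    then have "le (T y) (T x)"
      using trans[OF _ _ _ _ i(4), of "T y"] T_in xy i(1,2) M by auto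
    then show ?thesis using trans[OF xy(1) i(1) xy(2) i(3)] eqv_le[OF e] by simp
  qed
  show ?thesis
  proof (rule has_scd_intervalI[where L = "\<lambda>z. {y. eqv y (top (bot z))}"])
    fix x assume "x \<in> X" then show "r x \<le> N" by (rule bound)
  next
    have L: "eqv (top (bot x)) (top (bot y))"
      if "x \<in> X" "{z. eqv z (top (bot x))} = {z. eqv z (top (bot y))}" for x y
    proof -
      have "eqv (top (bot x)) (top (bot x))"
        using top_in[of "bot x"] bot[OF that(1)] eqv_refl by simp
      then show ?thesis using that(2) by blast
    qed
    have L': "{z. eqv z (top (bot x))} = {z. eqv z (top (bot y))}"
      if "eqv (top (bot x)) (top (bot y))" for x y
      using that eqv_sym eqv_trans by blast
    {
      fix x y assume xy: "x \<in> X" "y \<in> X" and le: "le x y" "le y x"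
      then have e: "eqv x y" by (simp add: eqv_def)
      have r: "r x = r y" by (rule eqv_r[OF e])
      have "eqv (bot x) (bot y)"
      proof (cases "r x \<le> M")
        case True
        then show ?thesis using e r by (simp add: bot_lower)
      next
        case False
        then have "T (bot x) = x" "T (bot y) = y" using bot_upper xy r by auto
        then have "le (bot x) (bot y)" "le (bot y) (bot x)"
          using T_inj[of "bot x" "bot y"] T_inj[of "bot y" "bot x"] bot[OF xy(1)] bot[OF xy(2)] le M
          by auto
        then show ?thesis using bot xy by (simp add: eqv_def)
      qed
      then show "{z. eqv z (top (bot x))} = {z. eqv z (top (bot y))} \<and> r x = r y"
        using L'[OF top_cong] bot[OF xy(1)] r by simp
    next
      fix x y assume xy: "x \<in> X" "y \<in> X" and l: "{z. eqv z (top (bot x))} = {z. eqv z (top (bot y))}"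
        and r: "r x \<le> r y"
      note t = L[OF xy(1) l]
      define x' y' where "x' = bot x" and "y' = bot y"
      have x': "x' \<in> X" "r x' \<le> M" and y': "y' \<in> X" "r y' \<le> M"
        using bot xy by (auto simp: x'_def y'_def)
      note Tx = T_in[OF x'(1), unfolded M, OF x'(2)] and Ty = T_in[OF y'(1), unfolded M, OF y'(2)]
      have t: "eqv (top x') (top y')" "eqv (top y') (top x')"
        using t eqv_sym by (auto simp: x'_def y'_def)
      consider "r y \<le> M" | "r x \<le> M" "M < r y" | "M < r x" "M < r y" using r by linarith
      then show "le x y"
      proof cases
        case 1
        then have "x' = x" "y' = y" using r by (auto simp: x'_def y'_def bot_lower)
        then show ?thesis using chain[OF xy r] 1 t by simp
      next
        case 2
        then have x: "x' = x" and y: "T y' = y" using bot_upper xy by (auto simp: x'_def y'_def bot_lower)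
        \<comment> \<open>A lower element against a reflected one: either \<open>x\<close> lies
          below \<open>y'\<close>, which lies below \<open>T y' = y\<close>, or \<open>y'\<close>
          lies below \<open>x\<close> and reflection turns this into \<open>T x\<close> below
          \<open>y\<close>, with \<open>x\<close> below \<open>T x\<close>.\<close>
        show ?thesis
        proof (cases "r x \<le> r y'")
          case True
          then have "le x y'" using chain[of x y'] x' y' x t by simp
          then show ?thesis using trans[OF xy(1) y'(1) xy(2)] Ty y by simp
        next
          case False
          then have "le (T x) y" using chain[of y' x] x' y' x y t by simp
          then show ?thesis using trans[OF xy(1) _ xy(2)] Tx x by blast
        qed
      next
        case 3
        then have x: "T x' = x" and y: "T y' = y" using bot_upper xy by (auto simp: x'_def y'_def)
        have "r x = N - r x'" "r y = N - r y'" using Tx Ty unfolding x y by blast+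
        then have "r y' \<le> r x'" using r bound[OF x'(1)] bound[OF y'(1)] by linarith
        then show ?thesis using chain[of y' x'] x' y' x y t by simp
      qed
    next
      fix x k assume x: "x \<in> X" and k: "min (r x) (N - r x) \<le> k" "k \<le> max (r x) (N - r x)"
      define x' where "x' = bot x"
      have x': "x' \<in> X" "r x' \<le> M" using bot x by (auto simp: x'_def)
      have r: "r x' \<le> k" "k \<le> N - r x'"
      proof -
        have "r x' = r x \<or> r x = N - r x'"
        proof (cases "r x \<le> M")
          case True
          then show ?thesis by (simp add: x'_def bot_lower)
        next
          case False
          then have "T x' = x" using bot_upper[OF x] by (simp add: x'_def)
          then show ?thesis using T_in[OF x'(1)] x'(2) M by metis
        qed
        moreover have "r x' \<le> N - r x'" using x'(2) by (simp add: M_def)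
        ultimately show "r x' \<le> k" "k \<le> N - r x'"
          using k bound[OF x] bound[OF x'(1)] by (auto simp: min_def max_def split: if_splits)
      qed
      have low_ex: "\<exists>y\<in>X. eqv (top y) (top x') \<and> r y = j" if j: "r x' \<le> j" "j \<le> M" for j
      proof -
        define y where "y = (up ^^ (j - r x')) x'"
        have y: "y \<in> X" "r y = j" using it[OF x'(1), of "j - r x'"] j M by (auto simp: y_def)
        have Mj: "M - r x' = (M - j) + (j - r x')" using j by linarith
        have "top x' = top y"
          unfolding top_def Mj y(2) by (simp only: funpow_add comp_apply y_def)
        then show ?thesis using y eqv_refl top_in[OF x'] by metis
      qed
      show "\<exists>y\<in>X. {z. eqv z (top (bot y))} = {z. eqv z (top (bot x))} \<and> r y = k"
      proof (cases "k \<le> M")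
        case True
        then obtain y where y: "y \<in> X" "eqv (top y) (top x')" "r y = k" using low_ex r by blast
        then have "bot y = y" using bot_lower True by simp
        then have "eqv (top (bot y)) (top (bot x))" using y(2) by (simp add: x'_def)
        then show ?thesis using y(1,3) L' by blast
      next
        case False
        then have "r x' \<le> N - k" "N - k \<le> M" using r by (auto simp: M_def)
        then obtain y where y: "y \<in> X" "eqv (top y) (top x')" "r y = N - k" using low_ex by blast
        have Ty: "T y \<in> X" "r (T y) = k"
          using T_in[OF y(1)] y(3) \<open>N - k \<le> M\<close> M r(2) by auto
        then have "T (bot (T y)) = T y" using bot_upper False by simp
        moreover have b: "bot (T y) \<in> X" "r (bot (T y)) \<le> M" using bot Ty by auto
        ultimately have "eqv (bot (T y)) y"
          using T_inj[of "bot (T y)" y] T_inj[of y "bot (T y)"] y(1,3) \<open>N - k \<le> M\<close> refl[OF Ty(1)] M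
          by (simp add: eqv_def)
        then have "eqv (top (bot (T y))) (top x')" using eqv_trans[OF top_cong y(2)] b(2) by blast
        then show ?thesis using Ty L' unfolding x'_def by blast
      qed
    }
  qed
qed

section \<open>Graded posets, and symmetric chain orders as posets of classes of a
  quasi-order\<close>

lemma covers_graded_iff:
  assumes strict: "\<And>p q. p \<in> P \<Longrightarrow> q \<in> P \<Longrightarrow> le p q \<Longrightarrow> p \<noteq> q \<Longrightarrow> (\<rho> p :: nat) < \<rho> q"
    and interp: "\<And>p q. p \<in> P \<Longrightarrow> q \<in> P \<Longrightarrow> le p q \<Longrightarrow> \<rho> p < \<rho> q
                   \<Longrightarrow> \<exists>z\<in>P. le p z \<and> le z q \<and> \<rho> z = Suc (\<rho> p)"
    and pq: "p \<in> P" "q \<in> P"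
  shows "covers P le p q \<longleftrightarrow> le p q \<and> \<rho> q = Suc (\<rho> p)"
proof
  assume c: "covers P le p q"
  then have pq': "le p q" "p \<noteq> q" by (auto simp: covers_def)
  obtain z where z: "z \<in> P" "le p z" "le z q" "\<rho> z = Suc (\<rho> p)"
    using interp[OF pq pq'(1)] strict[OF pq pq'] by blast
  then have "z \<noteq> p" by auto
  then have "z = q" using c z unfolding covers_def by blast
  then show "le p q \<and> \<rho> q = Suc (\<rho> p)" using z pq' by simp
next
  assume a: "le p q \<and> \<rho> q = Suc (\<rho> p)"
  have False if "z \<in> P" "le p z" "le z q" "z \<noteq> p" "z \<noteq> q" for z
    using strict[of p z] strict[of z q] that pq a by force
  then show "covers P le p q" using a pq unfolding covers_def by force
qed

lemma saturated_chain_Cons: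
  assumes "saturated_chain P le xs" "covers P le p (hd xs)"
  shows "saturated_chain P le (p # xs)"
  using assms unfolding saturated_chain_def
  by (auto simp: nth_Cons hd_conv_nth covers_def split: nat.split)

lemma saturated_chain_rank:
  assumes cov: "\<And>p q. covers P le p q \<Longrightarrow> \<rho> q = Suc (\<rho> p)"
    and xs: "saturated_chain P le xs"
  shows "\<rho> (last xs) + 1 = \<rho> (hd xs) + length xs"
proof -
  have "\<rho> (xs ! i) = \<rho> (xs ! 0) + i" if "i < length xs" for i
    using that
  proof (induction i)
    case (Suc i)
    then have "covers P le (xs ! i) (xs ! Suc i)" using xs by (simp add: saturated_chain_def)
    from cov[OF this] show ?case using Suc by simp
  qed simp
  from this[of "length xs - 1"] show ?thesis
    using xs by (simp add: saturated_chain_def last_conv_nth hd_conv_nth)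
qed

lemma saturated_chain_ex:
  assumes cov: "\<And>p q. p \<in> P \<Longrightarrow> q \<in> P \<Longrightarrow> le p q \<Longrightarrow> \<rho> q = Suc (\<rho> p) \<Longrightarrow> covers P le p q"
    and eq: "\<And>p q. p \<in> P \<Longrightarrow> q \<in> P \<Longrightarrow> le p q \<Longrightarrow> p = q \<or> \<rho> p < \<rho> q"
    and interp: "\<And>p q. p \<in> P \<Longrightarrow> q \<in> P \<Longrightarrow> le p q \<Longrightarrow> \<rho> p < \<rho> q
                   \<Longrightarrow> \<exists>z\<in>P. le p z \<and> le z q \<and> \<rho> z = Suc (\<rho> p)"
    and pq: "p \<in> P" "q \<in> P" "le p q"
  shows "\<exists>xs. saturated_chain P le xs \<and> hd xs = p \<and> last xs = q"
  using pq
proof (induction "\<rho> q - \<rho> p" arbitrary: p rule: less_induct)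
  case less
  show ?case
  proof (cases "p = q")
    case True
    then show ?thesis using less.prems by (intro exI[of _ "[p]"]) (simp add: saturated_chain_def)
  next
    case False
    then have "\<rho> p < \<rho> q" using eq less.prems by blast
    then obtain z where z: "z \<in> P" "le p z" "le z q" "\<rho> z = Suc (\<rho> p)"
      using interp less.prems by blast
    then obtain xs where xs: "saturated_chain P le xs" "hd xs = z" "last xs = q"
      using less.hyps[of z] less.prems(2) \<open>\<rho> p < \<rho> q\<close> by fastforce
    have "covers P le p (hd xs)" using cov[OF less.prems(1) z(1,2,4)] xs(2) by simp
    then have "saturated_chain P le (p # xs)" by (rule saturated_chain_Cons[OF xs(1)])
    moreover have "xs \<noteq> []" using xs(1) by (simp add: saturated_chain_def)
    ultimately show ?thesis using xs(3) by (intro exI[of _ "p # xs"]) simp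
  qed
qed

text \<open>Interpolation forces every cover to raise \<open>\<rho>\<close> by exactly one, so the
  length of a saturated chain depends only on its ends. This is what evaluates the two definite
  descriptions in \<open>rank\<close>.\<close>

lemma graded_ranked:
  assumes poset: "poset_on P le" and fin: "finite P"
    and strict: "\<And>p q. p \<in> P \<Longrightarrow> q \<in> P \<Longrightarrow> le p q \<Longrightarrow> p \<noteq> q \<Longrightarrow> (\<rho> p :: nat) < \<rho> q"
    and interp: "\<And>p q. p \<in> P \<Longrightarrow> q \<in> P \<Longrightarrow> le p q \<Longrightarrow> \<rho> p < \<rho> q
                   \<Longrightarrow> \<exists>z\<in>P. le p z \<and> le z q \<and> \<rho> z = Suc (\<rho> p)"
    and b: "is_minimum P le b" "\<rho> b = 0"
  shows "ranked P le" and "\<And>p. p \<in> P \<Longrightarrow> rank P le p = \<rho> p"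
proof -
  note cov = covers_graded_iff[of P le \<rho>, OF strict interp]
  have cov1: "\<rho> q = Suc (\<rho> p)" if "covers P le p q" for p q
    using cov[of p q] that by (simp add: covers_def)
  have len: "\<rho> (last xs) + 1 = length xs" if "saturated_chain P le xs" "hd xs = b" for xs
    using saturated_chain_rank[of P le \<rho> xs, OF cov1 that(1)] that(2) b(2) by simp
  show "ranked P le"
    unfolding ranked_def using fin b(1) len by metis
  have min_unique: "(THE b. is_minimum P le b) = b"
    using b(1) poset by (intro the_equality) (auto simp: is_minimum_def poset_on_def)
  fix p assume p: "p \<in> P"
  have "b \<in> P" "le b p" using b(1) p by (auto simp: is_minimum_def)
  then have "\<exists>xs. saturated_chain P le xs \<and> hd xs = b \<and> last xs = p"
    using strict by (intro saturated_chain_ex[of P le \<rho>] interp p) (auto simp: cov)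
  then obtain xs where xs: "saturated_chain P le xs" "hd xs = b" "last xs = p" by blast
  show "rank P le p = \<rho> p"
    unfolding rank_def min_unique
  proof (rule the_equality)
    show "\<exists>xs. saturated_chain P le xs \<and> hd xs = b \<and> last xs = p \<and> length xs = Suc (\<rho> p)"
      using xs len[OF xs(1,2)] by auto
  next
    fix k assume "\<exists>xs. saturated_chain P le xs \<and> hd xs = b \<and> last xs = p \<and> length xs = Suc k"
    then show "k = \<rho> p" using len by fastforce
  qed
qed

text \<open>The image of \<open>f\<close> plays the poset of equivalence classes. Each label yields
  one list, with an element picked for every rank from \<open>s l\<close> to \<open>N - s l\<close>;
  the pick does not matter, since elements of the same label and rank have the same image.\<close>

lemma symmetric_chain_order_quotientI:
  fixes X :: "'x set" and f :: "'x \<Rightarrow> 'b"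
  assumes scd: "has_scd X le r N" and fin: "finite X"
    and le_iff: "\<And>x y. x \<in> X \<Longrightarrow> y \<in> X \<Longrightarrow> leP (f x) (f y) \<longleftrightarrow> le x y"
    and refl: "\<And>x. x \<in> X \<Longrightarrow> le x x"
    and trans: "\<And>x y z. x \<in> X \<Longrightarrow> y \<in> X \<Longrightarrow> z \<in> X \<Longrightarrow> le x y \<Longrightarrow> le y z \<Longrightarrow> le x z"
    and mono: "\<And>x y. x \<in> X \<Longrightarrow> y \<in> X \<Longrightarrow> le x y \<Longrightarrow> r x \<le> r y"
    and eqv: "\<And>x y. x \<in> X \<Longrightarrow> y \<in> X \<Longrightarrow> le x y \<Longrightarrow> r x = r y \<Longrightarrow> f x = f y"
    and interp: "\<And>x y. x \<in> X \<Longrightarrow> y \<in> X \<Longrightarrow> le x y \<Longrightarrow> r x < r y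
                   \<Longrightarrow> \<exists>z\<in>X. le x z \<and> le z y \<and> r z = Suc (r x)"
    and b: "b \<in> X" "r b = 0" "\<And>x. x \<in> X \<Longrightarrow> le b x"
  shows "symmetric_chain_order (f ` X) leP"
proof -
  define \<rho> where "\<rho> p = r (SOME x. x \<in> X \<and> f x = p)" for p
  have eq_iff: "f x = f y \<longleftrightarrow> le x y \<and> le y x" if xy: "x \<in> X" "y \<in> X" for x y
  proof
    assume "f x = f y"
    then show "le x y \<and> le y x"
      using le_iff[OF xy] le_iff[OF xy(2,1)] le_iff[OF xy(1,1)] refl[OF xy(1)] by simp
  next
    assume "le x y \<and> le y x"
    then show "f x = f y" using eqv[OF xy] mono[OF xy] mono[OF xy(2,1)] by simp
  qed
  have \<rho>: "\<rho> (f x) = r x" if x: "x \<in> X" for x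
  proof -
    define y where "y = (SOME y. y \<in> X \<and> f y = f x)"
    have y: "y \<in> X \<and> f y = f x" unfolding y_def by (rule someI[of _ x]) (use x in simp)
    then have "le x y" "le y x" using eq_iff[of y x] x by auto
    then have "r y = r x" using mono[of x y] mono[of y x] x y by simp
    then show ?thesis by (simp add: \<rho>_def y_def)
  qed
  have poset: "poset_on (f ` X) leP"
    unfolding poset_on_def
  proof (intro conjI ballI impI; (elim conjE)?)
    fix p q s assume "p \<in> f ` X" "q \<in> f ` X" "s \<in> f ` X" "leP p q" "leP q s"
    then obtain x y z where xyz: "x \<in> X" "y \<in> X" "z \<in> X" "p = f x" "q = f y" "s = f z"
      and le: "leP p q" "leP q s" by blast
    then have "le x z" using trans[OF xyz(1-3)] le_iff by simp
    then show "leP p s" using xyz le_iff by simp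
  next
    fix p q assume "p \<in> f ` X" "q \<in> f ` X" "leP p q" "leP q p"
    then obtain x y where "x \<in> X" "y \<in> X" "p = f x" "q = f y" "leP p q" "leP q p" by blast
    then show "p = q" using eq_iff[of x y] le_iff by simp
  next
    fix p assume "p \<in> f ` X"
    then show "leP p p" using le_iff refl by blast
  qed
  have strict: "\<rho> p < \<rho> q" if pq: "p \<in> f ` X" "q \<in> f ` X" "leP p q" "p \<noteq> q" for p q
  proof -
    obtain x y where xy: "x \<in> X" "y \<in> X" "p = f x" "q = f y" using pq(1,2) by blast
    then have "le x y" using pq(3) le_iff by simp
    then have "r x < r y" using mono[of x y] eqv[of x y] xy pq(4) by fastforce
    then show ?thesis using xy \<rho> by simp
  qed
  have interpP: "\<exists>z\<in>f ` X. leP p z \<and> leP z q \<and> \<rho> z = Suc (\<rho> p)"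
    if pq: "p \<in> f ` X" "q \<in> f ` X" "leP p q" "\<rho> p < \<rho> q" for p q
  proof -
    obtain x y where xy: "x \<in> X" "y \<in> X" "p = f x" "q = f y" using pq(1,2) by blast
    then obtain z where "z \<in> X" "le x z" "le z y" "r z = Suc (r x)"
      using interp[of x y] pq(3,4) le_iff \<rho> by auto
    then show ?thesis using xy le_iff \<rho> by (intro bexI[of _ "f z"]) auto
  qed
  have min: "is_minimum (f ` X) leP (f b)" using b le_iff by (auto simp: is_minimum_def)
  have "finite (f ` X)" using fin by simp
  note graded = graded_ranked[of "f ` X" leP \<rho> "f b", OF poset this strict interpP min]
  have ranked: "ranked (f ` X) leP" using graded(1) \<rho>[OF b(1)] b(2) by simp
  have rank: "rank (f ` X) leP (f x) = r x" if "x \<in> X" for x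
    using graded(2)[of "f x"] \<rho>[OF b(1)] \<rho>[OF that] b(2) that by simp
  have cov: "covers (f ` X) leP (f x) (f y)" if "x \<in> X" "y \<in> X" "le x y" "r y = Suc (r x)" for x y
    using covers_graded_iff[of "f ` X" leP \<rho> "f x" "f y", OF strict interpP] that le_iff \<rho> by simp

  obtain L :: "'x \<Rightarrow> 'x set" and s where l: "scd_labelling X le r N L s"
    using scd unfolding has_scd_def by blast
  note bounds = scd_labelling_bounds[OF l]
  have f_L: "L x = L y" if "x \<in> X" "y \<in> X" "f x = f y" for x y
    using scd_labelling_cong(1)[OF l that(1,2)] eq_iff that by blast
  have "Max (rank (f ` X) leP ` f ` X) = N"
  proof (rule Max_eqI)
    show "finite (rank (f ` X) leP ` f ` X)" using fin by simp
    fix k assume "k \<in> rank (f ` X) leP ` f ` X"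
    then obtain x where x: "x \<in> X" "k = r x" using rank by auto
    show "k \<le> N" using bounds(2)[OF x(1)] x(2) by simp
  next
    \<comment> \<open>The chain of the minimum starts at rank 0 and by symmetry ends at rank
      \<open>N\<close>, so \<open>N\<close> is attained.\<close>
    have "s (L b) = 0" using bounds(1)[OF b(1)] b(2) by simp
    then obtain x where "x \<in> X" "r x = N" using scd_labelling_fill[OF l b(1), of N] by auto
    then show "N \<in> rank (f ` X) leP ` f ` X" using rank by (metis imageI)
  qed
  note max = this
  define pick where "pick l k = (SOME y. y \<in> X \<and> L y = l \<and> r y = k)" for l k
  have pick: "pick (L x) k \<in> X \<and> L (pick (L x) k) = L x \<and> r (pick (L x) k) = k"
    if x: "x \<in> X" and k: "s (L x) \<le> k" "k + s (L x) \<le> N" for x k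
  proof -
    have "\<exists>y. y \<in> X \<and> L y = L x \<and> r y = k" using scd_labelling_fill[OF l x k] by blast
    then show ?thesis unfolding pick_def by (rule someI_ex)
  qed
  define ch where "ch l = map (\<lambda>k. f (pick l k)) [s l..<Suc (N - s l)]" for l
  have len: "length (ch (L x)) = Suc (N - s (L x)) - s (L x)" for x
    by (simp add: ch_def del: upt_Suc)
  have nth: "ch (L x) ! i = f (pick (L x) (s (L x) + i))" if "i < length (ch (L x))" for x i
    using that nth_upt[of "s (L x)" i "Suc (N - s (L x))"] len[of x] by (simp add: ch_def del: upt_Suc)
  have sym: "symmetric_chain (f ` X) leP (ch (L x))" if x: "x \<in> X" for x
  proof -
    have sN: "s (L x) + s (L x) \<le> N" using bounds[OF x] by simp
    then have ne: "ch (L x) \<noteq> []" using len[of x] by auto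
    have in_X: "pick (L x) (s (L x) + i) \<in> X \<and> L (pick (L x) (s (L x) + i)) = L x
        \<and> r (pick (L x) (s (L x) + i)) = s (L x) + i" if "i < length (ch (L x))" for i
      by (rule pick[OF x]) (use that len[of x] in auto)
    have sat: "saturated_chain (f ` X) leP (ch (L x))"
      unfolding saturated_chain_def
    proof (intro conjI allI impI)
      show "set (ch (L x)) \<subseteq> f ` X"
      proof
        fix p assume "p \<in> set (ch (L x))"
        then obtain i where "i < length (ch (L x))" "p = ch (L x) ! i" by (metis in_set_conv_nth)
        then show "p \<in> f ` X" using nth in_X by simp
      qed
      fix i assume i: "Suc i < length (ch (L x))"
      then have i': "i < length (ch (L x))" by simp
      have "le (pick (L x) (s (L x) + i)) (pick (L x) (s (L x) + Suc i))"
        by (rule scd_labelling_le[OF l]) (use in_X[OF i] in_X[OF i'] in auto)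
      then show "covers (f ` X) leP (ch (L x) ! i) (ch (L x) ! Suc i)"
        unfolding nth[OF i] nth[OF i'] using in_X[OF i] in_X[OF i'] by (intro cov) auto
    qed (rule ne)
    have h: "hd (ch (L x)) = f (pick (L x) (s (L x)))"
      using nth[of 0 x] ne by (simp add: hd_conv_nth)
    have "last (ch (L x)) = f (pick (L x) (s (L x) + (length (ch (L x)) - 1)))"
      using nth[of "length (ch (L x)) - 1" x] ne by (simp add: last_conv_nth)
    moreover have "s (L x) + (length (ch (L x)) - 1) = N - s (L x)"
      using len[of x] sN by simp
    ultimately have t: "last (ch (L x)) = f (pick (L x) (N - s (L x)))" by simp
    have "rank (f ` X) leP (hd (ch (L x))) = s (L x)"
      using pick[OF x, of "s (L x)"] sN h rank by simp
    moreover have "rank (f ` X) leP (last (ch (L x))) = N - s (L x)"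
      using pick[OF x, of "N - s (L x)"] sN t rank by simp
    ultimately show ?thesis unfolding symmetric_chain_def using sat max sN by simp
  qed
  have in_ch: "\<exists>u\<in>X. L u = L x \<and> p = f u" if x: "x \<in> X" and p: "p \<in> set (ch (L x))" for x p
  proof -
    obtain k where k: "s (L x) \<le> k" "k < Suc (N - s (L x))" "p = f (pick (L x) k)"
      using p by (auto simp: ch_def simp del: upt_Suc)
    then have "k + s (L x) \<le> N" using bounds[OF x] by linarith
    from pick[OF x k(1) this] show ?thesis using k(3) by blast
  qed
  have self: "f x \<in> set (ch (L x))" if x: "x \<in> X" for x
  proof -
    note b = bounds[OF x]
    note p = pick[OF x b]
    have "le (pick (L x) (r x)) x" using scd_labelling_le[OF l _ x] p by auto
    then have "f (pick (L x) (r x)) = f x" using eqv[OF _ x] p by blast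
    moreover have "r x \<in> set [s (L x)..<Suc (N - s (L x))]" using b by auto
    ultimately show ?thesis unfolding ch_def by (metis (no_types, lifting) image_eqI list.set_map)
  qed
  show ?thesis
    unfolding symmetric_chain_order_def
  proof (intro conjI poset ranked exI[of _ "(\<lambda>x. ch (L x)) ` X"])
    show "\<forall>xs\<in>(\<lambda>x. ch (L x)) ` X. symmetric_chain (f ` X) leP xs" using sym by blast
    show "\<forall>xs\<in>(\<lambda>x. ch (L x)) ` X. \<forall>ys\<in>(\<lambda>x. ch (L x)) ` X. xs \<noteq> ys \<longrightarrow> set xs \<inter> set ys = {}"
    proof (intro ballI impI)
      fix xs ys assume "xs \<in> (\<lambda>x. ch (L x)) ` X" "ys \<in> (\<lambda>x. ch (L x)) ` X" "xs \<noteq> ys"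
      then obtain x y where xy: "x \<in> X" "y \<in> X" "xs = ch (L x)" "ys = ch (L y)" by blast
      have "xs = ys" if p: "p \<in> set xs" "p \<in> set ys" for p
      proof -
        obtain u v where "u \<in> X" "v \<in> X" "L u = L x" "L v = L y" "p = f u" "p = f v"
          using in_ch[OF xy(1)] in_ch[OF xy(2)] p xy(3,4) by metis
        then have "L x = L y" using f_L[of u v] by simp
        then show ?thesis using xy(3,4) by simp
      qed
      then show "set xs \<inter> set ys = {}" using \<open>xs \<noteq> ys\<close> by blast
    qed
    show "(\<Union>xs\<in>(\<lambda>x. ch (L x)) ` X. set xs) = f ` X"
    proof
      show "(\<Union>xs\<in>(\<lambda>x. ch (L x)) ` X. set xs) \<subseteq> f ` X" using in_ch by blast
      show "f ` X \<subseteq> (\<Union>xs\<in>(\<lambda>x. ch (L x)) ` X. set xs)" using self by blast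
    qed
  qed
qed

section \<open>Cyclic bracket matching\<close>

text \<open>In a periodic word, 0 (\<open>False\<close>) is an opening and 1 (\<open>True\<close>) a closing bracket; an \<open>arc\<close> is a matched
  pair and a \<open>free\<close> position an unmatched 0.\<close>

definition sg :: "bool \<Rightarrow> int" where "sg b = (if b then - 1 else 1)"

text \<open>The height gained from \<open>i\<close> to \<open>j\<close> by the lattice path that
  steps up at a 0 and down at a 1. It is 0 for \<open>j < i\<close>, which is why
  \<open>bal_split\<close> asks for ordered bounds.\<close>

definition bal :: "(int \<Rightarrow> bool) \<Rightarrow> int \<Rightarrow> int \<Rightarrow> int" where
  "bal w i j = (\<Sum>k\<in>{i..<j}. sg (w k))"

definition periodic :: "int \<Rightarrow> (int \<Rightarrow> bool) \<Rightarrow> bool" where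
  "periodic N w \<longleftrightarrow> (\<forall>i. w (i + N) = w i)"

definition rot :: "int \<Rightarrow> (int \<Rightarrow> bool) \<Rightarrow> int \<Rightarrow> bool" where
  "rot s w i = w (i + s)"

definition arc :: "(int \<Rightarrow> bool) \<Rightarrow> int \<Rightarrow> int \<Rightarrow> bool" where
  "arc w a b \<longleftrightarrow> a < b \<and> \<not> w a \<and> w b \<and> bal w a (b + 1) = 0 \<and> (\<forall>k. a < k \<and> k \<le> b \<longrightarrow> 0 < bal w a k)"

text \<open>Matching brackets around a circle is matching them in the periodic continuation, so the
  condition runs over all later positions and not over one period.\<close>

definition free :: "(int \<Rightarrow> bool) \<Rightarrow> int \<Rightarrow> bool" where
  "free w a \<longleftrightarrow> \<not> w a \<and> (\<forall>k>a. 0 < bal w a k)"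

definition next_free :: "(int \<Rightarrow> bool) \<Rightarrow> int \<Rightarrow> int \<Rightarrow> bool" where
  "next_free w q p \<longleftrightarrow> free w q \<and> free w p \<and> q < p \<and> (\<forall>k. q < k \<and> k < p \<longrightarrow> \<not> free w k)"

definition fill :: "(int \<Rightarrow> bool) \<Rightarrow> int \<Rightarrow> bool" where
  "fill w i \<longleftrightarrow> w i \<or> free w i"

definition set_one :: "int \<Rightarrow> int \<Rightarrow> (int \<Rightarrow> bool) \<Rightarrow> int \<Rightarrow> bool" where
  "set_one N p w i \<longleftrightarrow> w i \<or> N dvd i - p"

lemma sg_simps [simp]: "sg True = - 1" "sg False = 1"
  by (simp_all add: sg_def)

lemma sg_not [simp]: "sg (\<not> b) = - sg b"
  by (simp add: sg_def)

lemma bal_empty [simp]: "bal w i i = 0"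
  by (simp add: bal_def)

lemma bal_split: "i \<le> j \<Longrightarrow> j \<le> k \<Longrightarrow> bal w i k = bal w i j + bal w j k"
  unfolding bal_def by (subst sum.union_disjoint[symmetric]) (auto simp: ivl_disj_un)

lemma bal_single [simp]: "bal w i (i + 1) = sg (w i)"
proof -
  have "{i..<i + 1} = {i}" by auto
  then show ?thesis by (simp add: bal_def)
qed

lemma bal_Suc: "i \<le> j \<Longrightarrow> bal w i (j + 1) = bal w i j + sg (w j)"
  using bal_split[of i j "j + 1" w] by simp

lemma bal_left: "i < j \<Longrightarrow> bal w i j = sg (w i) + bal w (i + 1) j"
  using bal_split[of i "i + 1" j w] by simp

lemma bal_cong: "(\<And>k. i \<le> k \<Longrightarrow> k < j \<Longrightarrow> w k = w' k) \<Longrightarrow> bal w i j = bal w' i j"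
  unfolding bal_def by (rule sum.cong) auto

lemma bal_rot: "bal (rot s w) i j = bal w (i + s) (j + s)"
  unfolding bal_def rot_def
  by (rule sum.reindex_bij_witness[where i = "\<lambda>k. k - s" and j = "\<lambda>k. k + s"]) auto

lemma rot_rot: "rot s (rot s' w) = rot (s + s') w"
  by (auto simp: rot_def add.assoc)

lemma rot_0 [simp]: "rot 0 w = w"
  by (auto simp: rot_def)

lemma periodic_rot: "periodic N w \<Longrightarrow> rot N w = w"
  by (auto simp: periodic_def rot_def)

lemma periodic_rot_multiple: "periodic N w \<Longrightarrow> rot (k * N) w = w"
proof (induction k rule: int_induct[where k = 0])
  case (step1 i)
  then show ?case using rot_rot[of N "i * N" w] periodic_rot[of N w] by (simp add: algebra_simps)
next
  case (step2 i)
  then show ?case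
    using rot_rot[of "(i - 1) * N" N w] periodic_rot[of N w] by (simp add: algebra_simps)
qed simp

lemma periodic_rotI: "periodic N w \<Longrightarrow> periodic N (rot s w)"
  unfolding periodic_def rot_def by (metis add.assoc add.commute)

lemma bal_period:
  assumes "periodic N w" "0 \<le> N"
  shows "bal w i (i + N) = bal w 0 N"
proof -
  have *: "bal w (j + 1) (j + 1 + N) = bal w j (j + N)" for j
  proof -
    have "bal w j (j + N + 1) = bal w j (j + N) + sg (w (j + N))"
      using assms by (intro bal_Suc) simp
    moreover have "bal w j (j + N + 1) = sg (w j) + bal w (j + 1) (j + N + 1)"
      using assms by (intro bal_left) simp
    moreover have "w (j + N) = w j" using assms(1) by (simp add: periodic_def)
    ultimately show ?thesis by (simp add: algebra_simps)
  qed
  show ?thesis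
  proof (induction i rule: int_induct[where k = 0])
    case (step2 i)
    then show ?case using *[of "i - 1"] by simp
  qed (use * in simp_all)
qed

lemma arc_rot: "arc (rot s w) a b \<longleftrightarrow> arc w (a + s) (b + s)"
proof -
  have "(\<forall>k. a < k \<and> k \<le> b \<longrightarrow> 0 < bal w (a + s) (k + s)) \<longleftrightarrow>
    (\<forall>k. a + s < k \<and> k \<le> b + s \<longrightarrow> 0 < bal w (a + s) k)"
    by (metis add_le_cancel_right add_less_cancel_right diff_add_cancel)
  then show ?thesis unfolding arc_def bal_rot by (simp add: rot_def algebra_simps)
qed

lemma free_rot: "free (rot s w) a \<longleftrightarrow> free w (a + s)"
proof -
  have "(\<forall>k>a. 0 < bal w (a + s) (k + s)) \<longleftrightarrow> (\<forall>k>a + s. 0 < bal w (a + s) k)"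
    by (metis add_less_cancel_right diff_add_cancel)
  then show ?thesis unfolding free_def bal_rot by (simp add: rot_def)
qed

lemma free_periodic: "periodic N w \<Longrightarrow> free w (a + k * N) \<longleftrightarrow> free w a"
  using free_rot[of "k * N" w a] by (simp add: periodic_rot_multiple)

lemma arc_periodic: "periodic N w \<Longrightarrow> arc w (a + k * N) (b + k * N) \<longleftrightarrow> arc w a b"
  using arc_rot[of "k * N" w a b] by (simp add: periodic_rot_multiple)

lemma next_free_rot: "next_free (rot s w) q p \<longleftrightarrow> next_free w (q + s) (p + s)"
proof -
  have "(\<forall>k. q < k \<and> k < p \<longrightarrow> \<not> free w (k + s)) \<longleftrightarrow>
      (\<forall>k. q + s < k \<and> k < p + s \<longrightarrow> \<not> free w k)"
    by (metis add_less_cancel_right diff_add_cancel)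
  then show ?thesis unfolding next_free_def free_rot by simp
qed

lemma fill_rot: "fill (rot s w) = rot s (fill w)"
  by (auto simp: fill_def rot_def free_rot)

lemma periodic_fill: "periodic N w \<Longrightarrow> periodic N (fill w)"
  using free_periodic[of N w _ 1] by (simp add: periodic_def fill_def)

lemma periodic_set_one: "periodic N w \<Longrightarrow> periodic N (set_one N p w)"
  unfolding periodic_def set_one_def
  by (metis add.commute diff_add_eq dvd_add_triv_left_iff)

section \<open>Arcs, free positions and gaps\<close>

lemma arc_cong:
  assumes "\<And>k. a \<le> k \<Longrightarrow> k \<le> b \<Longrightarrow> w k = w' k"
  shows "arc w a b \<longleftrightarrow> arc w' a b"
proof -
  have "bal w a k = bal w' a k" if "k \<le> b + 1" for k
    using that assms by (intro bal_cong) auto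
  then show ?thesis unfolding arc_def using assms by (metis add.commute dual_order.refl less_imp_le zle_add1_eq_le zless_add1_eq)
qed

lemma arc_unique_right:
  assumes "arc w a b" "arc w a b'"
  shows "b = b'"
proof -
  have False if "arc w a b" "arc w a b'" "b < b'" for b b'
    using that unfolding arc_def by (metis add1_zle_eq less_add_one less_irrefl less_trans)
  then show ?thesis using assms by (meson linorder_neqE)
qed

lemma arc_unique_left:
  assumes "arc w a b" "arc w a' b"
  shows "a = a'"
proof -
  have False if "arc w a b" "arc w a' b" "a < a'" for a a'
    using that bal_split[of a a' "b + 1" w] unfolding arc_def by force
  then show ?thesis using assms by (meson linorder_neqE)
qed

lemma arc_not_free:
  assumes "arc w a b" "a \<le> k" "k \<le> b"
  shows "\<not> free w k"
proof
  assume "free w k"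
  then have "0 < bal w k (b + 1)" using assms by (simp add: free_def)
  moreover have "bal w a k + bal w k (b + 1) = 0"
    using assms bal_split[of a k "b + 1" w] by (simp add: arc_def)
  moreover have "0 \<le> bal w a k"
    using assms by (cases "a = k") (auto simp: arc_def intro: less_imp_le)
  ultimately show False by simp
qed

text \<open>The partner is the last position from which the balance up to and including
  \<open>b\<close> is nonnegative. The start of the period that ends at \<open>b\<close> is one such
  position, because a period has nonnegative balance.\<close>

lemma one_in_arc:
  assumes "periodic N w" "0 < N" "0 \<le> bal w 0 N" "w b"
  shows "\<exists>a. arc w a b"
proof -
  define S where "S = {a \<in> {b + 1 - N..b}. 0 \<le> bal w a (b + 1)}"
  have S: "finite S" by (rule finite_subset[of _ "{b + 1 - N..b}"]) (auto simp: S_def)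
  have "b + 1 - N \<in> S"
    using assms bal_period[OF assms(1), of "b + 1 - N"] by (simp add: S_def)
  then have "S \<noteq> {}" by blast
  define a where "a = Max S"
  have a: "a \<in> S" unfolding a_def by (rule Max_in) fact+
  have "a \<noteq> b" using a assms(4) by (auto simp: S_def)
  then have ab: "a < b" and a0: "0 \<le> bal w a (b + 1)" using a by (auto simp: S_def)
  have neg: "bal w k (b + 1) < 0" if "a < k" "k \<le> b" for k
  proof (rule ccontr)
    assume "\<not> ?thesis"
    then have "k \<in> S" using that a by (simp add: S_def)
    then have "k \<le> a" unfolding a_def using S by simp
    then show False using that by simp
  qed
  have "bal w a (b + 1) = sg (w a) + bal w (a + 1) (b + 1)" using ab by (intro bal_left) simp
  then have z: "bal w a (b + 1) = 0" "\<not> w a"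
    using a0 neg[of "a + 1"] ab by (auto simp: sg_def split: if_splits)
  have "0 < bal w a k" if "a < k" "k \<le> b" for k
    using neg[OF that] z(1) bal_split[of a k "b + 1" w] that by simp
  then show ?thesis using ab z assms(4) unfolding arc_def by blast
qed

text \<open>The path moves in unit steps, so it stays above its starting height until it first
  returns there, and that first return closes an arc.\<close>

lemma zero_free_or_arc:
  assumes "\<not> w a"
  shows "free w a \<or> (\<exists>b. arc w a b)"
proof (rule disjCI)
  assume "\<not> (\<exists>b. arc w a b)"
  have *: "0 < bal w a (a + 1 + int n)" for n
  proof (induction n rule: less_induct)
    case (less n)
    show ?case
    proof (cases n)
      case 0
      then show ?thesis using assms by simp
    next
      case (Suc m)
      define b where "b = a + 1 + int m"
      have pos: "0 < bal w a k" if "a < k" "k \<le> b" for k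
        using less[of "nat (k - a - 1)"] that Suc by (simp add: b_def)
      have "bal w a (b + 1) = bal w a b + sg (w b)" by (rule bal_Suc) (simp add: b_def)
      moreover have "\<not> arc w a b" using \<open>\<not> (\<exists>b. arc w a b)\<close> by blast
      ultimately have "0 < bal w a (b + 1)"
        using pos[of b] pos assms unfolding arc_def by (cases "w b") (force simp: b_def)+
      then show ?thesis by (simp add: b_def Suc algebra_simps)
    qed
  qed
  have "0 < bal w a k" if "a < k" for k
    using *[of "nat (k - a - 1)"] that by simp
  then show "free w a" using assms by (simp add: free_def)
qed


text \<open>The last minimum of the height within a period is free: the path does not return to it
  during the following period, and after that every period adds a positive amount.\<close>

lemma free_ex:
  assumes "periodic N w" "0 < N" "0 < bal w 0 N"
  shows "\<exists>q. free w q"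
proof -
  define m where "m = Min (bal w 0 ` {0..<N})"
  have m_le: "m \<le> bal w 0 k" if "0 \<le> k" "k < N" for k
    unfolding m_def using that by (intro Min_le) auto
  define S where "S = {q \<in> {0..<N}. bal w 0 q = m}"
  have S: "finite S" by (rule finite_subset[of _ "{0..<N}"]) (auto simp: S_def)
  have "m \<in> bal w 0 ` {0..<N}" unfolding m_def using assms(2) by (intro Min_in) auto
  then have "S \<noteq> {}" by (auto simp: S_def)
  define q where "q = Max S"
  have q: "q \<in> S" unfolding q_def by (rule Max_in) fact+
  have q0: "0 \<le> q" "q < N" "bal w 0 q = m" using q by (auto simp: S_def)
  have q_max: "m < bal w 0 k" if "q < k" "k < N" for k
  proof -
    have "k \<notin> S" using Max_ge[OF S, of k] that(1) by (auto simp: q_def)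
    then show ?thesis using m_le[of k] that q0 by (auto simp: S_def)
  qed
  have 1: "0 < bal w q k" if "q < k" "k \<le> q + N" for k
  proof (cases "k < N")
    case True
    then show ?thesis using q_max[OF that(1)] bal_split[of 0 q k w] q0 that by simp
  next
    case False
    have "bal w 0 k = bal w 0 (k - N) + bal w (k - N) k"
      using False assms(2) by (intro bal_split) auto
    also have "bal w (k - N) k = bal w 0 N"
      using bal_period[OF assms(1), of "k - N"] assms(2) by simp
    finally have "m < bal w 0 k" using m_le[of "k - N"] False that q0 assms(3) by simp
    then show ?thesis using bal_split[of 0 q k w] q0 that by simp
  qed
  have 2: "0 < bal w q (q + 1 + int n)" for n
  proof (induction n rule: less_induct)
    case (less n)
    define k where "k = q + 1 + int n"
    show ?case
    proof (cases "k \<le> q + N")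
      case True
      then show ?thesis using 1[of k] by (simp add: k_def)
    next
      case False
      have "nat (k - N - q - 1) < n" "q + 1 + int (nat (k - N - q - 1)) = k - N"
        using False assms(2) by (auto simp: k_def)
      then have "0 < bal w q (k - N)" using less by metis
      moreover have "bal w q k = bal w q (k - N) + bal w (k - N) k"
        using False assms(2) by (intro bal_split) auto
      moreover have "bal w (k - N) k = bal w 0 N"
        using bal_period[OF assms(1), of "k - N"] assms(2) by simp
      ultimately show ?thesis using assms(3) by (simp add: k_def)
    qed
  qed
  have "0 < bal w q k" if "q < k" for k
    using 2[of "nat (k - q - 1)"] that by simp
  moreover from this[of "q + 1"] have "\<not> w q" by (auto simp: sg_def split: if_splits)
  ultimately show ?thesis unfolding free_def by blast
qed

lemma no_free:
  assumes "periodic N w" "0 < N" "bal w 0 N \<le> 0"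
  shows "\<not> free w q"
proof
  assume "free w q"
  then have "0 < bal w q (q + N)" using assms(2) by (simp add: free_def)
  then show False using bal_period[OF assms(1), of q] assms(2,3) by simp
qed

lemma next_free_unique:
  assumes "next_free w q p" "next_free w q p'"
  shows "p = p'"
  using assms unfolding next_free_def by (meson linorder_neqE)

text \<open>The next free position after \<open>q\<close> is where the height above \<open>q\<close> is 1 for the last time.\<close>

lemma next_free_ex:
  assumes w: "periodic N w" "0 < N" and q: "free w q"
  shows "\<exists>p. next_free w q p \<and> p \<le> q + N \<and> bal w q p = 1"
proof -
  have qN: "free w (q + N)" using free_periodic[OF w(1), of q 1] q by simp
  have pos: "0 < bal w q k" if "q < k" for k using q that by (simp add: free_def)
  define S where "S = {k \<in> {q<..q + N}. bal w q k = 1}"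
  have S: "finite S" by (rule finite_subset[of _ "{q<..q + N}"]) (auto simp: S_def)
  have "q + 1 \<in> S" using q w(2) by (auto simp: S_def free_def)
  then have "S \<noteq> {}" by blast
  define p where "p = Max S"
  have "p \<in> S" unfolding p_def by (rule Max_in) fact+
  then have p: "q < p" "p \<le> q + N" "bal w q p = 1" by (auto simp: S_def)
  have p_max: "1 < bal w q k" if "p < k" for k
  proof (cases "k \<le> q + N")
    case True
    have "k \<notin> S" using Max_ge[OF S, of k] that by (auto simp: p_def)
    then show ?thesis using True that p(1) pos[of k] by (auto simp: S_def)
  next
    case False
    have "0 < bal w (q + N) k" using False qN by (simp add: free_def)
    then show ?thesis
      using bal_split[of q "q + N" k w] False w(2) pos[of "q + N"] by simp
  qed
  have pos_p: "0 < bal w p k" if "p < k" for k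
    using p_max[OF that] bal_split[of q p k w] p that by simp
  moreover from this[of "p + 1"] have "\<not> w p" by (auto simp: sg_def split: if_splits)
  ultimately have "free w p" by (simp add: free_def)
  moreover have "\<not> free w k" if "q < k" "k < p" for k
  proof
    assume "free w k"
    then have "0 < bal w k p" using that by (simp add: free_def)
    then show False using bal_split[of q k p w] that p(3) pos[of k] by simp
  qed
  ultimately show ?thesis using p q unfolding next_free_def by blast
qed

lemma next_free_bal:
  assumes "periodic N w" "0 < N" "next_free w q p"
  shows "bal w q p = 1" "p \<le> q + N"
proof -
  have "free w q" using assms(3) by (simp add: next_free_def)
  then obtain p' where "next_free w q p'" "p' \<le> q + N" "bal w q p' = 1"
    using next_free_ex assms(1,2) by blast
  then show "bal w q p = 1" "p \<le> q + N" using next_free_unique assms(3) by blast+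
qed

section \<open>Filling all free positions\<close>

lemma fill_eq_on_arc:
  assumes "arc w a b" "a \<le> k" "k \<le> b"
  shows "fill w k = w k"
  using arc_not_free[OF assms] by (simp add: fill_def)

lemma arc_fill: "arc w a b \<Longrightarrow> arc (fill w) a b"
  using arc_cong[of a b w "fill w"] fill_eq_on_arc by metis

text \<open>From one free position to the next the height rises by 1. The free position alone
  accounts for this, and the rest of the gap is balanced and unchanged, so filling turns each rise
  into a fall by 1.\<close>

lemma bal_fill_free:
  assumes w: "periodic N w" "0 < N" and "free w q" "free w p" "q \<le> p"
  shows "bal (fill w) q p = - bal w q p"
  using assms(3-)
proof (induction "nat (p - q)" arbitrary: q rule: less_induct)
  case less
  show ?case
  proof (cases "q = p")
    case False
    obtain q' where q': "next_free w q q'" using next_free_ex[OF w less.prems(1)] by blast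
    then have "q < q'" "free w q'" by (auto simp: next_free_def)
    have "q' \<le> p" using q' False less.prems unfolding next_free_def by (metis leI order_le_less)
    have "bal (fill w) q q' = sg (fill w q) + bal (fill w) (q + 1) q'" by (rule bal_left) fact
    also have "bal (fill w) (q + 1) q' = bal w (q + 1) q'"
      using q' by (intro bal_cong) (auto simp: next_free_def fill_def)
    also have "\<dots> = bal w q q' - sg (w q)" using bal_left[OF \<open>q < q'\<close>, of w] by simp
    finally have "bal (fill w) q q' = - bal w q q'"
      using next_free_bal(1)[OF w q'] less.prems(1)
      by (simp add: fill_def[of w q]) (simp add: free_def)
    moreover have "bal (fill w) q' p = - bal w q' p"
      using less.hyps[of q'] \<open>q < q'\<close> \<open>q' \<le> p\<close> \<open>free w q'\<close> less.prems(2) by simp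
    ultimately show ?thesis
      using bal_split[of q q' p] \<open>q < q'\<close> \<open>q' \<le> p\<close> by simp
  qed simp
qed

lemma bal_fill:
  assumes w: "periodic N w" "0 < N" "0 \<le> bal w 0 N"
  shows "bal (fill w) 0 N = - bal w 0 N"
proof (cases "bal w 0 N = 0")
  case True
  then have "fill w = w" using no_free[OF w(1,2)] by (auto simp: fill_def)
  then show ?thesis using True by simp
next
  case False
  then obtain q where q: "free w q" using free_ex[OF w(1,2)] w(3) by auto
  then have "free w (q + N)" using free_periodic[OF w(1), of q 1] by simp
  then have "bal (fill w) q (q + N) = - bal w q (q + N)"
    using bal_fill_free[OF w(1,2) q] w(2) by simp
  then show ?thesis using bal_period[OF w(1)] bal_period[OF periodic_fill[OF w(1)]] w(2) by simp
qed

text \<open>The ones of \<open>w\<close> can be recognised in \<open>fill w\<close> as those that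
  close an arc there. A filled position closes none: the opening zero would be matched already in
  \<open>w\<close>, and by \<open>arc_unique_right\<close> with the same position, which was
  free.\<close>

lemma fill_inj:
  assumes "periodic N w" "0 < N" "0 \<le> bal w 0 N"
    and "periodic N w'" "0 \<le> bal w' 0 N" and "fill w = fill w'"
  shows "w = w'"
proof -
  have *: "w i \<longleftrightarrow> fill w i \<and> (\<exists>a. arc (fill w) a i)"
    if w: "periodic N w" "0 \<le> bal w 0 N" for w i
  proof
    assume "w i"
    then show "fill w i \<and> (\<exists>a. arc (fill w) a i)"
      using one_in_arc[OF w(1) assms(2) w(2)] arc_fill unfolding fill_def[of w i] by blast
  next
    assume "fill w i \<and> (\<exists>a. arc (fill w) a i)"
    then obtain a where i: "fill w i" and a: "arc (fill w) a i" by blast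
    show "w i"
    proof (rule ccontr)
      assume "\<not> w i"
      then have "free w i" using i by (simp add: fill_def)
      have "\<not> fill w a" using a by (simp add: arc_def)
      then obtain b where "arc w a b" using zero_free_or_arc[of w a] by (auto simp: fill_def)
      moreover from this have "b = i" using arc_fill arc_unique_right a by blast
      ultimately show False
        using arc_not_free[of w a b i] \<open>free w i\<close> by (simp add: arc_def)
    qed
  qed
  show ?thesis using *[OF assms(1,3)] *[OF assms(4,5)] assms(6) by auto
qed

section \<open>Closing one free position\<close>

lemma arc_set_one:
  assumes "periodic N w" "free w p" "arc w a b"
  shows "arc (set_one N p w) a b"
proof -
  have "w k = set_one N p w k" if "a \<le> k" "k \<le> b" for k
  proof -
    have "\<not> N dvd k - p"
    proof
      assume "N dvd k - p"
      then obtain j where "k - p = N * j" ..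
      then have "k = p + j * N" by (simp add: algebra_simps)
      then have "free w k" using free_periodic[OF assms(1)] assms(2) by simp
      then show False using arc_not_free[OF assms(3) that] by simp
    qed
    then show ?thesis by (simp add: set_one_def)
  qed
  then show ?thesis using arc_cong assms(3) by blast
qed

text \<open>All old arcs survive, so closing a free position frees no other one. This makes
  \<open>fill\<close> reverse the order along a raise, as the reflection requires.\<close>

lemma fill_set_one_le:
  assumes "periodic N w" "free w p" "fill (set_one N p w) i"
  shows "fill w i"
proof (cases "set_one N p w i")
  case True
  then show ?thesis
  proof (cases "w i")
    case False
    then have "N dvd i - p" using True by (simp add: set_one_def)
    then obtain j where "i - p = N * j" ..
    then have "i = p + j * N" by (simp add: algebra_simps)
    then show ?thesis using free_periodic[OF assms(1)] assms(2) by (simp add: fill_def)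
  qed (simp add: fill_def)
next
  case False
  then have f: "free (set_one N p w) i" "\<not> w i" using assms(3) by (auto simp: fill_def set_one_def)
  then have "\<not> (\<exists>b. arc w i b)"
    using arc_set_one[OF assms(1,2)] arc_not_free[of "set_one N p w" i _ i]
    by (metis arc_def less_imp_le order_refl)
  then show ?thesis using zero_free_or_arc f(2) by (auto simp: fill_def)
qed

lemma not_dvd_gap: "0 < k - p \<Longrightarrow> k - p < N \<Longrightarrow> \<not> N dvd (k - p :: int)"
  by (simp add: zdvd_not_zless)

lemma bal_set_one:
  assumes "periodic N w" "0 < N" "\<not> w p"
  shows "bal (set_one N p w) 0 N = bal w 0 N - 2"
proof -
  have nd: "\<not> N dvd k - p" if "p < k" "k < p + N" for k
    by (rule not_dvd_gap) (use that in auto)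
  have "bal (set_one N p w) (p + 1) (p + N) = bal w (p + 1) (p + N)"
    by (rule bal_cong) (simp add: set_one_def nd)
  moreover have "bal w p (p + N) = sg (w p) + bal w (p + 1) (p + N)"
    "bal (set_one N p w) p (p + N) = sg (set_one N p w p) + bal (set_one N p w) (p + 1) (p + N)"
    using assms(2) by (auto intro!: bal_left)
  ultimately have "bal (set_one N p w) p (p + N) = bal w p (p + N) - 2"
    using assms(3) by (simp add: set_one_def)
  then show ?thesis
    using bal_period[OF assms(1)] bal_period[OF periodic_set_one[OF assms(1)]] assms(2) by simp
qed

text \<open>An arc contains no free position, so it is enclosed by the last free position before it
  and the successor of that position.\<close>

lemma arc_gap:
  assumes w: "periodic N w" "0 < N" "0 < bal w 0 N" and "arc w a b"
  shows "\<exists>q p. next_free w q p \<and> q < a \<and> b < p"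
proof -
  obtain q0 where q0: "free w q0" using free_ex[OF w] by blast
  \<comment> \<open>A translate of \<open>q0\<close> by so many periods that it is at most
    \<open>a\<close>, whatever the signs of \<open>q0\<close> and \<open>a\<close>.\<close>
  define q1 where "q1 = q0 - (\<bar>q0\<bar> + \<bar>a\<bar>) * N"
  have q1: "free w q1" using free_periodic[OF w(1), of q0 "- (\<bar>q0\<bar> + \<bar>a\<bar>)"] q0
    by (simp add: q1_def algebra_simps)
  have "(\<bar>q0\<bar> + \<bar>a\<bar>) * 1 \<le> (\<bar>q0\<bar> + \<bar>a\<bar>) * N" using w(2) by (intro mult_left_mono) auto
  then have "q1 \<le> a" by (simp add: q1_def)
  define S where "S = {k \<in> {q1..a}. free w k}"
  have S: "finite S" by (rule finite_subset[of _ "{q1..a}"]) (auto simp: S_def)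
  have "q1 \<in> S" using q1 \<open>q1 \<le> a\<close> by (simp add: S_def)
  then have "S \<noteq> {}" by blast
  define q where "q = Max S"
  have "q \<in> S" unfolding q_def by (rule Max_in) fact+
  then have q: "free w q" "q \<le> a" "q1 \<le> q" by (auto simp: S_def)
  have nf: "\<not> free w k" if "a \<le> k" "k \<le> b" for k using arc_not_free[OF assms(4) that] .
  have "a < b" using assms(4) by (simp add: arc_def)
  then have "q \<noteq> a" using nf[of a] q by auto
  obtain p where p: "next_free w q p" using next_free_ex[OF w(1,2) q(1)] by blast
  have "b < p"
  proof (rule ccontr)
    assume "\<not> b < p"
    then have "p < a" using nf[of p] p by (auto simp: next_free_def)
    then have "p \<in> S" using p q(3) by (auto simp: S_def next_free_def)
    then have "p \<le> q" unfolding q_def using S by simp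
    then show False using p by (simp add: next_free_def)
  qed
  then show ?thesis using p q(2) \<open>q \<noteq> a\<close> by (meson order_le_imp_less_or_eq)
qed

text \<open>The height above \<open>q\<close> is 1 on reaching \<open>p\<close>, so a one at
  \<open>p\<close> brings it back to 0 for the first time. The bound on \<open>p\<close> keeps
  \<open>q\<close> out of the residue class that is changed.\<close>

lemma arc_set_one_new:
  assumes w: "periodic N w" "0 < N" and p: "next_free w q p" "p < q + N"
  shows "arc (set_one N p w) q p"
proof -
  have qp: "q < p" and wq: "\<not> w q" using p by (auto simp: next_free_def free_def)
  have nd: "\<not> N dvd k - p" if "q \<le> k" "k < p" for k
    using not_dvd_gap[of p k N] that p(2) by (simp add: dvd_diff_commute)
  have eq: "bal (set_one N p w) q k = bal w q k" if "k \<le> p" for k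
    by (rule bal_cong) (use that nd in \<open>simp add: set_one_def\<close>)
  have "bal (set_one N p w) q (p + 1) = bal (set_one N p w) q p + sg (set_one N p w p)"
    using qp by (intro bal_Suc) simp
  then have "bal (set_one N p w) q (p + 1) = 0"
    using eq[of p] next_free_bal(1)[OF w p(1)] by (simp add: set_one_def)
  moreover have "0 < bal (set_one N p w) q k" if "q < k" "k \<le> p" for k
    using eq[of k] that p(1) by (simp add: next_free_def free_def)
  moreover have "\<not> set_one N p w q" using wq nd[of q] qp by (simp add: set_one_def)
  ultimately show ?thesis using qp unfolding arc_def by (simp add: set_one_def)
qed

definition widest_gap :: "(int \<Rightarrow> bool) \<Rightarrow> int \<Rightarrow> int \<Rightarrow> bool" where
  "widest_gap w q p \<longleftrightarrow> next_free w q p \<and> (\<forall>q' p'. next_free w q' p' \<longrightarrow> p' - q' \<le> p - q)"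

text \<open>Closing a widest gap creates the only longest arc, which can therefore be recovered.\<close>

lemma arcs_of_set_one:
  assumes w: "periodic N w" "0 < N" "2 \<le> bal w 0 N"
    and p: "widest_gap w q p" "p < q + N" and ab: "arc (set_one N p w) a b"
  shows "N dvd b - p \<and> b - a = p - q \<or> b - a < p - q"
proof (cases "N dvd b - p")
  case True
  then obtain j where "b - p = N * j" ..
  then have b: "b = p + j * N" by (simp add: algebra_simps)
  have "next_free w q p" using p(1) by (simp add: widest_gap_def)
  then have "arc (set_one N p w) (q + j * N) b"
    using arc_set_one_new[OF w(1,2) _ p(2)] arc_periodic[OF periodic_set_one[OF w(1)]]
    unfolding b by blast
  then have "a = q + j * N" using ab arc_unique_left by blast
  then show ?thesis using True b by simp
next
  case False
  then have "w b" using ab by (simp add: arc_def set_one_def)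
  then obtain a' where a': "arc w a' b" using one_in_arc[OF w(1,2)] w(3) by auto
  have "free w p" using p(1) by (simp add: widest_gap_def next_free_def)
  then have "a' = a" using arc_set_one[OF w(1) _ a'] ab arc_unique_left by blast
  obtain q' p' where "next_free w q' p'" "q' < a'" "b < p'"
    using arc_gap[OF w(1,2) _ a'] w(3) by auto
  then show ?thesis using p(1) \<open>a' = a\<close> unfolding widest_gap_def by force
qed

text \<open>Both new arcs occur in the common word. By \<open>arcs_of_set_one\<close> for either
  word, neither can be strictly shorter than the other, so their ends are congruent modulo
  \<open>N\<close>; clearing this residue class recovers both words.\<close>

lemma set_one_inj:
  assumes w: "periodic N w" "0 < N" "2 \<le> bal w 0 N"
    and p: "widest_gap w q p" "p < q + N"
    and w': "periodic N w'" "2 \<le> bal w' 0 N"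
    and p': "widest_gap w' q' p'" "p' < q' + N"
    and eq: "set_one N p w = set_one N p' w'"
  shows "w = w'"
proof -
  have n: "next_free w q p" "next_free w' q' p'" using p p' by (auto simp: widest_gap_def)
  have "arc (set_one N p w) q p" "arc (set_one N p w) q' p'"
    using arc_set_one_new[OF w(1,2) n(1) p(2)] arc_set_one_new[OF w'(1) w(2) n(2) p'(2)] eq by auto
  then have d: "N dvd p' - p"
    using arcs_of_set_one[OF w p, of q' p'] arcs_of_set_one[OF w'(1) w(2) w'(2) p', of q p] eq
    by fastforce
  have dvd_iff: "N dvd i - p \<longleftrightarrow> N dvd i - p'" for i
    using d dvd_diff_right_iff[of N "p' - p" "i - p"] by (metis diff_add_cancel diff_diff_eq2 dvd_add_left_iff add_diff_eq diff_diff_eq)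
  have z: "\<not> v i" if v: "periodic N v" "free v r" and i: "N dvd i - r" for v r i
  proof -
    obtain j where "i - r = N * j" using i ..
    then have "i = r + j * N" by (simp add: algebra_simps)
    then have "free v i" using free_periodic[OF v(1)] v(2) by simp
    then show ?thesis by (simp add: free_def)
  qed
  have "w i \<longleftrightarrow> set_one N p w i \<and> \<not> N dvd i - p" for i
    using z[OF w(1), of p i] n by (auto simp: set_one_def next_free_def)
  moreover have "w' i \<longleftrightarrow> set_one N p' w' i \<and> \<not> N dvd i - p'" for i
    using z[OF w'(1), of p' i] n by (auto simp: set_one_def next_free_def)
  ultimately show ?thesis using eq dvd_iff by auto
qed

section \<open>Necklaces\<close>

definition weight :: "int \<Rightarrow> (int \<Rightarrow> bool) \<Rightarrow> nat" where
  "weight N w = card {i \<in> {0..<N}. w i}"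

text \<open>Multiples of \<open>c\<close> start a block, and within each block the ones come first:
  these are the words made of unary codes.\<close>

definition block_sorted :: "int \<Rightarrow> (int \<Rightarrow> bool) \<Rightarrow> bool" where
  "block_sorted c w \<longleftrightarrow> (\<forall>i. w i \<and> \<not> c dvd i \<longrightarrow> w (i - 1))"

definition words :: "int \<Rightarrow> int \<Rightarrow> (int \<Rightarrow> bool) set" where
  "words c N = {w. periodic N w \<and> block_sorted c w}"

definition rot_le :: "int \<Rightarrow> (int \<Rightarrow> bool) \<Rightarrow> (int \<Rightarrow> bool) \<Rightarrow> bool" where
  "rot_le t w w' \<longleftrightarrow> (\<exists>k. \<forall>i. w i \<longrightarrow> rot (k * t) w' i)"

lemma bal_weight:
  assumes "0 \<le> N"
  shows "bal w 0 N = N - 2 * int (weight N w)"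
proof -
  have "bal w 0 N = (\<Sum>i\<in>{0..<N}. 1 - 2 * (if w i then 1 else 0))"
    unfolding bal_def by (rule sum.cong) (auto simp: sg_def)
  also have "\<dots> = N - 2 * (\<Sum>i\<in>{0..<N}. if w i then 1 else 0)"
    using assms by (simp add: sum_subtractf flip: sum_distrib_left)
  also have "(\<Sum>i\<in>{0..<N}. if w i then 1 else 0) = int (weight N w)"
    by (simp add: weight_def sum.If_cases Int_def)
  finally show ?thesis .
qed

lemma weight_rot:
  assumes "periodic N w" "0 \<le> N"
  shows "weight N (rot s w) = weight N w"
proof -
  have "bal (rot s w) 0 N = bal w 0 N"
    using bal_period[OF assms, of s] by (simp add: bal_rot add.commute)
  then show ?thesis using bal_weight[OF assms(2)] by simp
qed

lemma weight_mono:
  assumes "\<And>i. w i \<Longrightarrow> w' i"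
  shows "weight N w \<le> weight N w'"
  unfolding weight_def
  by (rule card_mono[OF finite_subset[of _ "{0..<N}"]]) (use assms in auto)

lemma weight_le: "weight N w \<le> nat N"
proof -
  have "weight N w \<le> card {0..<N}" unfolding weight_def by (rule card_mono) auto
  then show ?thesis by simp
qed

lemma periodic_mod:
  assumes "periodic N w"
  shows "w (i mod N) = w i"
  using fun_cong[OF periodic_rot_multiple[OF assms, of "i div N"], of "i mod N"]
  by (simp add: rot_def)

lemma weight_eq_imp_eq:
  assumes "periodic N w" "periodic N w'" "0 < N" "\<And>i. w i \<Longrightarrow> w' i" "weight N w = weight N w'"
  shows "w = w'"
proof -
  have sub: "{i \<in> {0..<N}. w i} \<subseteq> {i \<in> {0..<N}. w' i}" using assms(4) by blast
  have fin: "finite {i \<in> {0..<N}. w' i}" by (rule finite_subset[of _ "{0..<N}"]) auto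
  have "{i \<in> {0..<N}. w i} = {i \<in> {0..<N}. w' i}"
    by (rule card_subset_eq[OF fin sub assms(5)[unfolded weight_def]])
  then have "w j = w' j" if "0 \<le> j" "j < N" for j
    using that by (metis (mono_tags, lifting) atLeastLessThan_iff mem_Collect_eq)
  then have "w (i mod N) = w' (i mod N)" for i using assms(3) by simp
  then show ?thesis using periodic_mod[OF assms(1)] periodic_mod[OF assms(2)] by auto
qed

lemma finite_words: "0 < N \<Longrightarrow> finite (words c N)"
proof -
  assume N: "0 < N"
  have "inj_on (\<lambda>w. {i \<in> {0..<N}. w i}) (words c N)"
  proof (rule inj_onI)
    fix w w' assume w: "w \<in> words c N" "w' \<in> words c N" "{i \<in> {0..<N}. w i} = {i \<in> {0..<N}. w' i}"
    then have "w j = w' j" if "0 \<le> j" "j < N" for j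
    using that by (metis (mono_tags, lifting) atLeastLessThan_iff mem_Collect_eq)
    then have "w (i mod N) = w' (i mod N)" for i using N by simp
    then show "w = w'" using periodic_mod w(1,2) unfolding words_def by blast
  qed
  moreover have "(\<lambda>w. {i \<in> {0..<N}. w i}) ` words c N \<subseteq> Pow {0..<N}" by auto
  ultimately show ?thesis using finite_imageD finite_subset by (metis finite_Pow_iff finite_atLeastLessThan_int)
qed

lemma weight_fill:
  assumes "periodic N w" "0 < N" "2 * int (weight N w) \<le> N"
  shows "int (weight N (fill w)) = N - int (weight N w)"
  using bal_fill[OF assms(1,2)] assms(2,3) by (simp add: bal_weight)

text \<open>A zero directly before a free position is free as well, since the path lies one higher
  above it.\<close>

lemma block_sorted_fill:
  assumes "block_sorted c w"
  shows "block_sorted c (fill w)"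
  unfolding block_sorted_def
proof (intro allI impI; elim conjE)
  fix i assume i: "fill w i" "\<not> c dvd i"
  show "fill w (i - 1)"
  proof (cases "w (i - 1)")
    case False
    then have "free w i" using i assms by (auto simp: fill_def block_sorted_def)
    have "0 < bal w (i - 1) k" if "i - 1 < k" for k
    proof (cases "k = i")
      case True
      then show ?thesis using False bal_single[of w "i - 1"] by simp
    next
      case False
      then have "0 < bal w i k" using that \<open>free w i\<close> by (simp add: free_def)
      then show ?thesis using bal_left[OF that, of w] \<open>\<not> w (i - 1)\<close> by simp
    qed
    then show ?thesis using False by (simp add: fill_def free_def)
  qed (simp add: fill_def)
qed

lemma fill_in_words: "w \<in> words c N \<Longrightarrow> fill w \<in> words c N"
  by (simp add: words_def periodic_fill block_sorted_fill)

text \<open>Taking \<open>i\<close> to \<open>- 1 - i\<close> maps blocks to blocks in reverse, and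
  complementing puts the ones back in front of the zeros.\<close>

lemma reverse_complement:
  assumes "w \<in> words c N" "0 \<le> N"
  shows "(\<lambda>i. \<not> w (- 1 - i)) \<in> words c N"
    and "int (weight N (\<lambda>i. \<not> w (- 1 - i))) = N - int (weight N w)"
proof -
  have per: "periodic N w" using assms by (simp add: words_def)
  have "w (- 1 - (i + N)) = w (- 1 - i)" for i
    using fun_cong[OF periodic_rot[OF per], of "- 1 - (i + N)"] by (simp add: rot_def)
  moreover have "block_sorted c (\<lambda>i. \<not> w (- 1 - i))"
    unfolding block_sorted_def
  proof (intro allI impI; elim conjE)
    fix i assume i: "\<not> w (- 1 - i)" "\<not> c dvd i"
    then have "\<not> c dvd - i" by simp
    moreover have "- i - 1 = - 1 - i" by simp
    then have "\<not> w (- i - 1)" using i(1) by (simp only: not_False_eq_True)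
    ultimately have "\<not> w (- i)" using assms(1) unfolding words_def block_sorted_def by blast
    then show "\<not> w (- 1 - (i - 1))" by (simp add: algebra_simps)
  qed
  ultimately show "(\<lambda>i. \<not> w (- 1 - i)) \<in> words c N"
    by (simp add: words_def periodic_def)
  have "bal (\<lambda>i. \<not> w (- 1 - i)) 0 N = (\<Sum>j\<in>{- N..<- N + N}. sg (\<not> w j))"
    unfolding bal_def
    by (rule sum.reindex_bij_witness[where i = "\<lambda>k. - 1 - k" and j = "\<lambda>k. - 1 - k"]) auto
  also have "\<dots> = - bal w (- N) (- N + N)" by (simp add: bal_def sum_negf)
  also have "\<dots> = - bal w 0 N" using bal_period[OF per assms(2), of "- N"] by simp
  finally show "int (weight N (\<lambda>i. \<not> w (- 1 - i))) = N - int (weight N w)"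
    using assms(2) by (simp add: bal_weight)
qed

text \<open>\<open>fill\<close> injects rank \<open>N - k\<close> into rank \<open>k\<close>, and reversing a complemented word shows that these ranks
  have the same size.\<close>

lemma fill_surj:
  assumes "0 < N" and z: "z \<in> words c N" "N < 2 * int (weight N z)"
  shows "\<exists>w\<in>words c N. 2 * int (weight N w) \<le> N \<and> fill w = z"
proof -
  define S where "S k = {w \<in> words c N. int (weight N w) = k}" for k
  have fin: "finite (S k)" for k using finite_words[OF assms(1)] by (simp add: S_def)
  define k where "k = int (weight N z)"
  have sub: "fill ` S (N - k) \<subseteq> S k"
  proof
    fix v assume "v \<in> fill ` S (N - k)"
    then obtain w where w: "w \<in> words c N" "int (weight N w) = N - k" "v = fill w"
      by (auto simp: S_def)
    then have "2 * int (weight N w) \<le> N" using z(2) by (simp add: k_def)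
    then have "int (weight N v) = k"
      using weight_fill[of N w] w assms(1) by (simp add: words_def)
    then show "v \<in> S k" using fill_in_words[OF w(1)] w(3) by (simp add: S_def)
  qed
  have "inj_on fill (S (N - k))"
  proof (rule inj_onI)
    fix w w' assume w: "w \<in> S (N - k)" "w' \<in> S (N - k)" and eq: "fill w = fill w'"
    have *: "periodic N v \<and> 0 \<le> bal v 0 N" if "v \<in> S (N - k)" for v
      using that z(2) assms(1) by (simp add: S_def words_def bal_weight k_def)
    show "w = w'" using fill_inj[OF _ assms(1) _ _ _ eq] *[OF w(1)] *[OF w(2)] by blast
  qed
  then have card_fill: "card (fill ` S (N - k)) = card (S (N - k))" by (rule card_image)
  have "card (S k) \<le> card (S (N - k))"
  proof (rule card_inj_on_le[OF _ _ fin])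
    show "inj_on (\<lambda>w i. \<not> w (- 1 - i)) (S k)"
    proof (rule inj_onI)
      fix w w' :: "int \<Rightarrow> bool" assume "(\<lambda>i. \<not> w (- 1 - i)) = (\<lambda>i. \<not> w' (- 1 - i))"
      then have "w (- 1 - (- 1 - i)) = w' (- 1 - (- 1 - i))" for i by metis
      then show "w = w'" by auto
    qed
    show "(\<lambda>w i. \<not> w (- 1 - i)) ` S k \<subseteq> S (N - k)"
      using reverse_complement assms(1) by (auto simp: S_def)
  qed
  then have "fill ` S (N - k) = S k"
    unfolding card_fill[symmetric] by (rule card_seteq[OF fin sub])
  moreover have "z \<in> S k" using z(1) by (simp add: S_def k_def)
  ultimately have "z \<in> fill ` S (N - k)" by (simp only:)
  then obtain w where w: "w \<in> S (N - k)" "z = fill w" ..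
  have "w \<in> words c N" "2 * int (weight N w) \<le> N" using w(1) z(2) by (simp_all add: S_def k_def)
  then show ?thesis using w(2) by blast
qed

text \<open>A relation, since several gaps may be widest, and in a word with a rotational symmetry
  no rule that commutes with rotations can choose one of them modulo \<open>N\<close>. The bound
  excludes a gap of a whole period, whose two ends would be changed together.\<close>

definition raise :: "int \<Rightarrow> (int \<Rightarrow> bool) \<Rightarrow> (int \<Rightarrow> bool) \<Rightarrow> bool" where
  "raise N w v \<longleftrightarrow> (\<exists>q p. widest_gap w q p \<and> p < q + N \<and> v = set_one N p w)"

lemma raise_rot:
  assumes "raise N w v"
  shows "raise N (rot s w) (rot s v)"
proof -
  obtain q p where qp: "widest_gap w q p" "p < q + N" "v = set_one N p w"
    using assms unfolding raise_def by blast
  have "widest_gap (rot s w) (q - s) (p - s)"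
    using qp(1) unfolding widest_gap_def next_free_rot by fastforce
  moreover have "rot s v = set_one N (p - s) (rot s w)"
    by (auto simp: qp(3) set_one_def rot_def algebra_simps)
  ultimately show ?thesis using qp(2) unfolding raise_def by (metis add_diff_eq diff_add_eq diff_strict_right_mono)
qed

text \<open>The difficulty is to keep the blocks sorted: the closed position must start a block or
  follow a one. If the widest gap is longer than 1, the path comes down to height 1 at its end, so a
  one precedes the end. If it has length 1, every position is free and a block start can be
  closed.\<close>

lemma raise_ex:
  assumes w: "w \<in> words c N" "0 < N" "2 * int (weight N w) + 2 \<le> N" and "c dvd N"
  shows "\<exists>v\<in>words c N. raise N w v"
proof -
  have per: "periodic N w" and srt: "block_sorted c w" using w by (auto simp: words_def)
  have b: "2 \<le> bal w 0 N" using w by (simp add: bal_weight)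
  obtain q0 where q0: "free w q0" using free_ex[OF per w(2)] b by auto
  define G where "G = {p - q | q p. next_free w q p}"
  have G: "finite G"
    by (rule finite_subset[of _ "{0..N}"])
      (use next_free_bal(2)[OF per w(2)] in \<open>force simp: G_def next_free_def\<close>)+
  obtain p0 where "next_free w q0 p0" using next_free_ex[OF per w(2) q0] by blast
  then have "G \<noteq> {}" by (auto simp: G_def)
  then have "Max G \<in> G" using G by simp
  then obtain q1 p1 where q1: "next_free w q1 p1" "Max G = p1 - q1" by (auto simp: G_def)
  then have wide1: "widest_gap w q1 p1"
    using Max_ge[OF G] by (auto simp: widest_gap_def G_def)
  have "\<exists>q p. widest_gap w q p \<and> (c dvd p \<or> w (p - 1))"
  proof (cases "p1 = q1 + 1")
    case True
    have step: "free w (q + 1) \<and> next_free w q (q + 1)" if q: "free w q" for q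
    proof -
      obtain p where p: "next_free w q p" using next_free_ex[OF per w(2) q] by blast
      then have "p - q \<le> 1" using wide1 True by (auto simp: widest_gap_def)
      then have "p = q + 1" using p by (simp add: next_free_def)
      then show ?thesis using p by (simp add: next_free_def)
    qed
    have "free w (q0 + int n)" for n
    proof (induction n)
      case (Suc n)
      then show ?case using step[of "q0 + int n"] by (simp add: algebra_simps)
    qed (use q0 in simp)
    \<comment> \<open>The run of free positions from \<open>q0\<close> on reaches one congruent to
      \<open>- 1\<close>, which yields the gap from \<open>- 1\<close> to the block start 0.\<close>
    moreover have "q0 \<le> - 1 + (\<bar>q0\<bar> + 1) * N"
    proof -
      have "q0 \<le> - 1 + (\<bar>q0\<bar> + 1) * 1" by simp
      also have "\<dots> \<le> - 1 + (\<bar>q0\<bar> + 1) * N"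
        using w(2) by (intro add_left_mono mult_left_mono) auto
      finally show ?thesis .
    qed
    ultimately have "free w (- 1 + (\<bar>q0\<bar> + 1) * N)"
      by (metis add_diff_cancel_left' zle_iff_zadd)
    then have "free w (- 1)" using free_periodic[OF per] by blast
    then have "next_free w (- 1) 0" using step[of "- 1"] by simp
    then have "widest_gap w (- 1) 0" using wide1 True by (simp add: widest_gap_def)
    then show ?thesis by (intro exI[of _ "- 1"] exI[of _ 0]) simp
  next
    case False
    then have lt: "q1 < p1 - 1" using q1(1) by (simp add: next_free_def)
    then have "0 < bal w q1 (p1 - 1)" using q1(1) by (simp add: next_free_def free_def)
    moreover have "bal w q1 (p1 - 1 + 1) = bal w q1 (p1 - 1) + sg (w (p1 - 1))"
      using lt by (intro bal_Suc) simp
    moreover have "bal w q1 p1 = 1" using next_free_bal[OF per w(2) q1(1)] by simp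
    ultimately have "w (p1 - 1)" by (auto simp: sg_def split: if_splits)
    then show ?thesis using wide1 by blast
  qed
  then obtain q p where qp: "widest_gap w q p" "c dvd p \<or> w (p - 1)" by blast
  then have nf: "next_free w q p" by (simp add: widest_gap_def)
  \<comment> \<open>A gap gains height 1, a whole period at least 2.\<close>
  have "p \<noteq> q + N"
    using next_free_bal(1)[OF per w(2) nf] bal_period[OF per, of q] w(2) b by auto
  then have "p < q + N" using next_free_bal(2)[OF per w(2) nf] by simp
  moreover have "block_sorted c (set_one N p w)"
    unfolding block_sorted_def
  proof (intro allI impI; elim conjE)
    fix i assume i: "set_one N p w i" "\<not> c dvd i"
    show "set_one N p w (i - 1)"
    proof (cases "w i")
      case True
      then show ?thesis using i srt by (simp add: set_one_def block_sorted_def)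
    next
      case False
      then obtain j where "i - p = N * j" using i by (auto simp: set_one_def)
      then have j: "i = p + j * N" by (simp add: algebra_simps)
      then have "\<not> c dvd p" using i(2) \<open>c dvd N\<close> by (simp add: dvd_add_left_iff)
      then have "w (p - 1)" using qp by simp
      then have "w (i - 1)"
        using fun_cong[OF periodic_rot_multiple[OF per, of j], of "p - 1"] by (simp add: rot_def j algebra_simps)
      then show ?thesis by (simp add: set_one_def)
    qed
  qed
  ultimately show ?thesis using qp per periodic_set_one unfolding raise_def words_def by blast
qed

lemma raise_weight:
  assumes "raise N w v" "periodic N w" "0 < N"
  shows "weight N v = Suc (weight N w)"
proof -
  obtain q p where qp: "widest_gap w q p" "v = set_one N p w" using assms(1) unfolding raise_def by blast
  then have "\<not> w p" by (simp add: widest_gap_def next_free_def free_def)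
  from bal_set_one[OF assms(2,3) this] show ?thesis using qp(2) assms(3) by (simp add: bal_weight)
qed

text \<open>Turns equivalence in the quasi-order into an actual rotation, with which
  \<open>raise\<close> and \<open>fill\<close> commute.\<close>

lemma rot_le_eq:
  assumes "rot_le t w v" "weight N w = weight N v" "periodic N w" "periodic N v" "0 < N"
  shows "\<exists>k. w = rot (k * t) v"
proof -
  obtain k where k: "\<And>i. w i \<Longrightarrow> rot (k * t) v i" using assms(1) by (auto simp: rot_le_def)
  have "w = rot (k * t) v"
    by (rule weight_eq_imp_eq[of N]) (use assms k in \<open>auto simp: periodic_rotI weight_rot\<close>)
  then show ?thesis ..
qed

lemma words_has_scd:
  assumes N: "0 < N" and "c dvd N"
  shows "has_scd (words c N) (rot_le t) (weight N) (nat N)"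
proof (rule has_scd_reflect[where R = "raise N" and T = fill])
  have rotI: "rot_le t (rot (k * t) w) w" "rot_le t w (rot (k * t) w)" for k w
  proof -
    show "rot_le t (rot (k * t) w) w" unfolding rot_le_def by blast
    have "rot (- k * t) (rot (k * t) w) = w" by (simp add: rot_rot)
    then show "rot_le t w (rot (k * t) w)" unfolding rot_le_def by metis
  qed
  have leI: "rot_le t w v" if "\<And>i. w i \<Longrightarrow> v i" for w v
    unfolding rot_le_def by (rule exI[of _ 0]) (simp add: that)
  have per: "periodic N w" if "w \<in> words c N" for w using that by (simp add: words_def)
  have half: "2 * k \<le> nat N \<longleftrightarrow> 2 * int k \<le> N" "2 * k + 2 \<le> nat N \<longleftrightarrow> 2 * int k + 2 \<le> N"
    "nat N < 2 * k \<longleftrightarrow> N < 2 * int k" for k using N by auto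
  show mono: "weight N w \<le> weight N v" if wv: "w \<in> words c N" "v \<in> words c N" "rot_le t w v" for w v
  proof -
    obtain k where "\<And>i. w i \<Longrightarrow> rot (k * t) v i" using wv(3) unfolding rot_le_def by blast
    then have "weight N w \<le> weight N (rot (k * t) v)" by (rule weight_mono)
    then show ?thesis using weight_rot[OF per[OF wv(2)]] N by simp
  qed
  show "rot_le t w w" for w by (rule leI)
  show "rot_le t u w" if "rot_le t u v" "rot_le t v w" for u v w
  proof -
    obtain j k where j: "\<And>i. u i \<Longrightarrow> v (i + j * t)" and k: "\<And>i. v i \<Longrightarrow> w (i + k * t)"
      using \<open>rot_le t u v\<close> \<open>rot_le t v w\<close> unfolding rot_le_def rot_def by blast
    have "\<forall>i. u i \<longrightarrow> w (i + (j + k) * t)" using k[OF j] by (simp add: algebra_simps)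
    then show ?thesis unfolding rot_le_def rot_def by blast
  qed
  have eq: "\<exists>k. w = rot (k * t) v"
    if "w \<in> words c N" "v \<in> words c N" "rot_le t w v" "rot_le t v w" for w v
    using that rot_le_eq[of t w v N] mono[of w v] mono[of v w] per N by simp
  show "rot_le t v w" if "w \<in> words c N" "v \<in> words c N" "rot_le t w v" "weight N w = weight N v" for w v
    using rot_le_eq[OF that(3,4)] per that N rotI by blast
  show "weight N w \<le> nat N" for w by (rule weight_le)
  show "\<exists>v\<in>words c N. raise N w v" if "w \<in> words c N" "2 * weight N w + 2 \<le> nat N" for w
    using raise_ex[OF that(1) N _ \<open>c dvd N\<close>] that(2) by (simp only: half)
  show "weight N v = Suc (weight N w) \<and> rot_le t w v \<and> rot_le t (fill v) (fill w)"
    if w: "w \<in> words c N" and r: "raise N w v" for w v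
  proof (intro conjI)
    show "weight N v = Suc (weight N w)" by (rule raise_weight[OF r per[OF w] N])
    obtain q p where qp: "widest_gap w q p" "v = set_one N p w" using r unfolding raise_def by blast
    then have "free w p" by (simp add: widest_gap_def next_free_def)
    then show "rot_le t w v" "rot_le t (fill v) (fill w)"
      using fill_set_one_le[OF per[OF w]] qp(2) by (auto intro!: leI simp: set_one_def)
  qed
  show "rot_le t w w'"
    if w: "w \<in> words c N" "v \<in> words c N" "w' \<in> words c N" "v' \<in> words c N"
      and b: "2 * weight N w + 2 \<le> nat N" "2 * weight N w' + 2 \<le> nat N"
      and r: "raise N w v" "raise N w' v'" and le: "rot_le t v v'" "rot_le t v' v" for w v w' v'
  proof -
    obtain k where k: "v = rot (k * t) v'" using eq[OF w(2,4) le] by blast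
    \<comment> \<open>Rotating \<open>w'\<close> makes both raises end in the same word, so that
      \<open>set_one_inj\<close> applies.\<close>
    then have "raise N (rot (k * t) w') v" using raise_rot[OF r(2)] by simp
    moreover have "periodic N (rot (k * t) w')" "2 \<le> bal (rot (k * t) w') 0 N" "2 \<le> bal w 0 N"
      using b N by (simp_all add: periodic_rotI per[OF w(3)] bal_weight weight_rot)
    ultimately have "w = rot (k * t) w'"
      using set_one_inj[OF per[OF w(1)] N] r(1) unfolding raise_def by metis
    then show ?thesis using rotI by simp
  qed
  show "fill w \<in> words c N \<and> weight N (fill w) = nat N - weight N w \<and> rot_le t w (fill w)"
    if "w \<in> words c N" "2 * weight N w \<le> nat N" for w
    using that weight_fill[OF per N, of w] fill_in_words by (auto intro!: leI simp: fill_def half)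
  show "rot_le t (fill w) (fill v)"
    if "w \<in> words c N" "v \<in> words c N" "rot_le t w v" "rot_le t v w" for w v
    using eq[OF that] fill_rot rotI by metis
  show "rot_le t w v"
    if w: "w \<in> words c N" "v \<in> words c N" and b: "2 * weight N w \<le> nat N" "2 * weight N v \<le> nat N"
      and le: "rot_le t (fill w) (fill v)" "rot_le t (fill v) (fill w)" for w v
  proof -
    obtain k where "fill w = rot (k * t) (fill v)"
      using eq[OF fill_in_words[OF w(1)] fill_in_words[OF w(2)] le] by blast
    then have f: "fill w = fill (rot (k * t) v)" by (simp add: fill_rot)
    have "w = rot (k * t) v"
    proof (rule fill_inj[OF per[OF w(1)] N _ periodic_rotI[OF per[OF w(2)]] _ f])
      show "0 \<le> bal w 0 N" using b(1) N by (simp add: bal_weight)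
      show "0 \<le> bal (rot (k * t) v) 0 N" using b(2) N by (simp add: bal_weight weight_rot per[OF w(2)])
    qed
    then show ?thesis using rotI by simp
  qed
  show "\<exists>w\<in>words c N. 2 * weight N w \<le> nat N \<and> fill w = z"
    if "z \<in> words c N" "nat N < 2 * weight N z" for z
    using fill_surj[OF N that(1)] that(2) by (simp add: half)
qed

section \<open>Tuples on a cycle\<close>

definition height_in :: "'a::linorder set \<Rightarrow> 'a \<Rightarrow> nat" where
  "height_in C a = card {b \<in> C. b < a}"

lemma height_in_less:
  assumes "finite C" "a \<in> C" "a < b"
  shows "height_in C a < height_in C b"
  unfolding height_in_def
  by (rule psubset_card_mono) (use assms in auto)

lemma height_in_le_iff:
  assumes "finite C" "a \<in> C" "b \<in> C"
  shows "height_in C a \<le> height_in C b \<longleftrightarrow> a \<le> b"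
  using assms height_in_less by (metis leD le_cases not_le order_le_less)

lemma bij_betw_height_in:
  assumes "finite C"
  shows "bij_betw (height_in C) C {..<card C}"
proof -
  have "inj_on (height_in C) C"
    using height_in_le_iff[OF assms] by (intro inj_onI) (metis antisym order_refl)
  moreover have "height_in C ` C \<subseteq> {..<card C}"
  proof
    fix k assume "k \<in> height_in C ` C"
    then obtain a where a: "a \<in> C" "k = height_in C a" by blast
    have "card {b \<in> C. b < a} < card C" by (rule psubset_card_mono) (use assms a in auto)
    then show "k \<in> {..<card C}" using a by (simp add: height_in_def)
  qed
  ultimately show ?thesis
    unfolding bij_betw_def using assms by (metis card_image card_lessThan card_subset_eq finite_lessThan)
qed

text \<open>Comparison modulo the group generated by the \<open>e\<close>-th power of the cycle.
  Natural exponents reach the whole group because a cycle on distinct entries has finite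
  order.\<close>

definition cycle_le :: "nat list \<Rightarrow> nat \<Rightarrow> (nat \<Rightarrow> 'a::linorder) \<Rightarrow> (nat \<Rightarrow> 'a) \<Rightarrow> bool" where
  "cycle_le q e x y \<longleftrightarrow> (\<exists>k. \<forall>i\<in>set q. x i \<le> y ((cycle_of_list q ^^ (e * k)) i))"

lemma cycle_of_list_funpow_nth:
  assumes "distinct q" "a < length q"
  shows "(cycle_of_list q ^^ j) (q ! a) = q ! ((a + j) mod length q)"
proof -
  have "(cycle_of_list q ^^ j) (q ! a) = rotate j q ! a"
    using cyclic_rotation[OF assms(1), of j] assms(2) by (metis nth_map)
  then show ?thesis using assms(2) by (simp add: nth_rotate add.commute)
qed

lemma cycle_le_nth:
  assumes "distinct q"
  shows "cycle_le q e x y \<longleftrightarrow>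
    (\<exists>k. \<forall>a<length q. x (q ! a) \<le> y (q ! ((a + e * k) mod length q)))"
  unfolding cycle_le_def by (simp add: all_set_conv_all_nth cycle_of_list_funpow_nth[OF assms])

text \<open>Block number \<open>a\<close> of the word, of length \<open>c = card C - 1\<close>, is \<open>1\<^sup>h 0\<^sup>c\<^sup>-\<^sup>h\<close> for the height \<open>h\<close> of entry \<open>a\<close>,
  so shifting the entries by one is rotating the word by \<open>c\<close>.\<close>

definition encode :: "'a::linorder set \<Rightarrow> nat list \<Rightarrow> (nat \<Rightarrow> 'a) \<Rightarrow> int \<Rightarrow> bool" where
  "encode C q x i \<longleftrightarrow> (let c = int (card C - 1) in
     i mod c < int (height_in C (x (q ! nat ((i div c) mod int (length q))))))"

lemma block_initial_segment:
  fixes P :: "nat \<Rightarrow> bool"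
  assumes "\<And>b. Suc b < c \<Longrightarrow> P (Suc b) \<Longrightarrow> P b"
  shows "\<exists>m\<le>c. \<forall>b<c. P b \<longleftrightarrow> b < m"
  using assms
proof (induction c)
  case (Suc c)
  then obtain m where m: "m \<le> c" "\<forall>b<c. P b \<longleftrightarrow> b < m" by force
  show ?case
  proof (cases "m = c \<and> P c")
    case True
    then show ?thesis using m by (intro exI[of _ "Suc c"]) (auto simp: less_Suc_eq)
  next
    case False
    have "\<not> P c"
    proof
      assume "P c"
      then have "m < c" using False m by auto
      then obtain b where "c = Suc b" "m \<le> b" by (cases c) auto
      then show False using Suc.prems[of b] m \<open>P c\<close> by auto
    qed
    then show ?thesis using m by (intro exI[of _ m]) (auto simp: less_Suc_eq)
  qed
qed simp

context
  fixes C :: "'a::linorder set" and q :: "nat list" and c n :: int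
  assumes C: "finite C" and q: "distinct q"
    and c_def: "c = int (card C - 1)" and c: "0 < c"
    and n_def: "n = int (length q)" and n: "0 < n"
begin

lemma encode_iff: "encode C q x i \<longleftrightarrow> i mod c < int (height_in C (x (q ! nat ((i div c) mod n))))"
  unfolding encode_def Let_def c_def n_def ..

lemma encode_block:
  assumes "a < length q" "b < nat c"
  shows "encode C q x (c * int a + int b) \<longleftrightarrow> b < height_in C (x (q ! a))"
  using assms c n by (simp add: encode_iff n_def)

lemma height_le_c: "x \<in> C \<Longrightarrow> int (height_in C x) \<le> c"
  using bij_betwE[OF bij_betw_height_in[OF C]] by (fastforce simp: c_def)

lemma block_decomp:
  assumes "0 \<le> i" "i < c * n"
  obtains a b where "a < length q" "b < nat c" "i = c * int a + int b"
proof -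
  have "c * (i div c) \<le> i" using c by (metis add.commute le_add_same_cancel1 mult_div_mod_eq pos_mod_sign)
  then have "c * (i div c) < c * n" using assms by simp
  then have "i div c < n" using c by simp
  moreover have "0 \<le> i div c" "0 \<le> i mod c" "i mod c < c" using assms c by (auto simp: pos_imp_zdiv_nonneg_iff)
  moreover have "i = c * (i div c) + i mod c" by simp
  ultimately show ?thesis
    using that[of "nat (i div c)" "nat (i mod c)"] by (simp add: n_def nat_less_iff)
qed

lemma encode_periodic: "periodic (c * n) (encode C q x)"
proof -
  have "(i + c * n) div c = i div c + n" "(i + c * n) mod c = i mod c" for i
    using c by auto
  then show ?thesis by (simp add: periodic_def encode_iff)
qed

lemma encode_block_sorted: "block_sorted c (encode C q x)"
  unfolding block_sorted_def
proof (intro allI impI; elim conjE)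
  fix i assume i: "encode C q x i" "\<not> c dvd i"
  have m: "0 < i mod c" using i(2) c by (metis dvd_eq_mod_eq_0 order_le_less pos_mod_sign)
  have "i - 1 = c * (i div c) + (i mod c - 1)" by simp
  moreover have "0 \<le> i mod c - 1" "i mod c - 1 < c" using m pos_mod_bound[OF c, of i] by auto
  ultimately have "(i - 1) div c = i div c" "(i - 1) mod c = i mod c - 1"
    using c by (metis int_div_pos_eq, metis int_mod_pos_eq)
  then show "encode C q x (i - 1)" using i(1) by (simp add: encode_iff)
qed

lemma encode_weight:
  assumes "x ` set q \<subseteq> C"
  shows "weight (c * n) (encode C q x) = (\<Sum>i\<in>set q. height_in C (x i))"
proof -
  have h: "height_in C (x (q ! a)) \<le> nat c" if "a < length q" for a
  proof -
    have "x (q ! a) \<in> C" using assms that by auto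
    then show ?thesis using height_le_c by fastforce
  qed
  have inj: "inj_on (\<lambda>(a, b). c * int a + int b) (SIGMA a:{..<length q}. {..<height_in C (x (q ! a))})"
  proof (rule inj_onI)
    fix p p'
    assume p: "p \<in> (SIGMA a:{..<length q}. {..<height_in C (x (q ! a))})"
      and p': "p' \<in> (SIGMA a:{..<length q}. {..<height_in C (x (q ! a))})"
      and eq: "(\<lambda>(a, b). c * int a + int b) p = (\<lambda>(a, b). c * int a + int b) p'"
    obtain a b a' b' where ab: "p = (a, b)" "p' = (a', b')" by fastforce
    have b: "int b < c" "int b' < c" using h[of a] h[of a'] p p' by (auto simp: ab)
    have "(c * int a + int b) div c = int a" "(c * int a' + int b') div c = int a'" using b c by auto
    then show "p = p'" using eq by (simp add: ab)
  qed
  have "{i \<in> {0..<c * n}. encode C q x i} =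
      (\<lambda>(a, b). c * int a + int b) ` (SIGMA a:{..<length q}. {..<height_in C (x (q ! a))})"
    (is "?A = ?B")
  proof (intro equalityI subsetI)
    fix i assume i: "i \<in> ?A"
    then obtain a b where ab: "a < length q" "b < nat c" "i = c * int a + int b"
      using block_decomp by auto
    then have "b < height_in C (x (q ! a))" using i encode_block by auto
    then show "i \<in> ?B" using ab by (intro image_eqI[of _ _ "(a, b)"]) auto
  next
    fix i assume "i \<in> ?B"
    then obtain a b where ab: "a < length q" "b < height_in C (x (q ! a))" "i = c * int a + int b" by auto
    then have b: "b < nat c" using h[of a] by simp
    have "c * int a + int b < c * (int a + 1)" using b by (simp add: algebra_simps)
    also have "\<dots> \<le> c * n" using ab(1) c n_def by (intro mult_left_mono) auto
    finally show "i \<in> ?A" using ab b c encode_block by auto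
  qed
  then have "weight (c * n) (encode C q x) = (\<Sum>a<length q. height_in C (x (q ! a)))"
    by (simp add: weight_def card_image[OF inj])
  also have "\<dots> = (\<Sum>i\<in>set q. height_in C (x i))"
    by (rule sum.reindex_bij_betw[OF bij_betw_nth[OF q refl refl]])
  finally show ?thesis .
qed

lemma encode_surj:
  assumes "w \<in> words c (c * n)"
  shows "\<exists>x\<in>set q \<rightarrow>\<^sub>E C. encode C q x = w"
proof -
  have per: "periodic (c * n) w" and srt: "block_sorted c w" using assms by (auto simp: words_def)
  have "\<exists>m\<le>nat c. \<forall>b<nat c. w (c * int a + int b) \<longleftrightarrow> b < m" for a
  proof (rule block_initial_segment)
    fix b assume b: "Suc b < nat c" "w (c * int a + int (Suc b))"
    then have "\<not> c dvd int (Suc b)" using zdvd_not_zless[of "int (Suc b)" c] by simp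
    then have "\<not> c dvd c * int a + int (Suc b)" by (simp add: dvd_add_right_iff)
    then have "w (c * int a + int (Suc b) - 1)" using srt b(2) unfolding block_sorted_def by blast
    then show "w (c * int a + int b)" by (simp add: algebra_simps)
  qed
  then obtain m where m: "\<And>a. m a \<le> nat c" "\<And>a b. b < nat c \<Longrightarrow> w (c * int a + int b) \<longleftrightarrow> b < m a"
    by metis
  have "\<exists>v\<in>C. height_in C v = m a" for a
  proof -
    have "m a < card C" using m(1)[of a] c by (simp add: c_def)
    then show ?thesis using bij_betw_imp_surj_on[OF bij_betw_height_in[OF C]] by (metis imageE lessThan_iff)
  qed
  then obtain v where v: "\<And>a. v a \<in> C" "\<And>a. height_in C (v a) = m a" by metis
  obtain ix where ix: "\<And>a. a < length q \<Longrightarrow> ix (q ! a) = a"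
    using inv_into_f_f[of "(!) q" "{..<length q}"] q by (metis inj_on_nth lessThan_iff)
  define x where "x = restrict (\<lambda>i. v (ix i)) (set q)"
  have x: "x \<in> set q \<rightarrow>\<^sub>E C" using v(1) by (simp add: x_def)
  have eq: "encode C q x i = w i" if i: "0 \<le> i" "i < c * n" for i
  proof -
    obtain a b where "a < length q" "b < nat c" "i = c * int a + int b" by (rule block_decomp[OF i])
    then show ?thesis using m(2) encode_block v(2) ix by (simp add: x_def)
  qed
  have "encode C q x i = w i" for i
    using eq[of "i mod (c * n)"] c n periodic_mod[OF per, of i] periodic_mod[OF encode_periodic, of x i]
    by simp
  then show ?thesis using x by blast
qed

text \<open>Rotating by \<open>c * e\<close> moves entries by \<open>e\<close> places and keeps
  offsets within blocks, and unary codes are comparable exactly as the heights are.\<close>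

lemma encode_le:
  assumes x: "x ` set q \<subseteq> C" and y: "y ` set q \<subseteq> C"
  shows "cycle_le q e x y \<longleftrightarrow> rot_le (c * int e) (encode C q x) (encode C q y)"
proof
  assume "cycle_le q e x y"
  then obtain k where k: "\<And>a. a < length q \<Longrightarrow> x (q ! a) \<le> y (q ! ((a + e * k) mod length q))"
    unfolding cycle_le_nth[OF q] by blast
  have "encode C q y (i + int k * (c * int e))" if "encode C q x i" for i
  proof -
    define a where "a = nat ((i div c) mod n)"
    have a: "a < length q" "int a = (i div c) mod n" using n by (auto simp: a_def n_def nat_less_iff)
    have "i + int k * (c * int e) = i + c * (int e * int k)" by (simp add: algebra_simps)
    have d: "(i + int k * (c * int e)) mod c = i mod c"
      "(i + int k * (c * int e)) div c = i div c + int e * int k"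
      unfolding \<open>i + int k * (c * int e) = _\<close> using c by simp_all
    have "int ((a + e * k) mod length q) = (i div c + int e * int k) mod n"
      by (simp add: zmod_int a(2) n_def mod_add_left_eq)
    then have "nat ((i div c + int e * int k) mod n) = (a + e * k) mod length q" by (metis nat_int)
    moreover have "height_in C (x (q ! a)) \<le> height_in C (y (q ! ((a + e * k) mod length q)))"
      using k[OF a(1)] height_in_le_iff[OF C] x y a(1) n
      by (metis imageI in_mono length_pos_if_in_set mod_less_divisor nth_mem)
    ultimately show ?thesis using that by (simp add: encode_iff d flip: a_def)
  qed
  then show "rot_le (c * int e) (encode C q x) (encode C q y)"
    unfolding rot_le_def rot_def by blast
next
  assume "rot_le (c * int e) (encode C q x) (encode C q y)"
  then obtain k where k: "\<And>i. encode C q x i \<Longrightarrow> encode C q y (i + k * (c * int e))"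
    unfolding rot_le_def rot_def by blast
  \<comment> \<open>Exponents in \<open>cycle_le\<close> are natural numbers; reducing modulo the
    length of the cycle makes the integer \<open>k\<close> one of them.\<close>
  define k' where "k' = nat (k mod n)"
  have k': "int k' = k mod n" using n by (simp add: k'_def)
  have "x (q ! a) \<le> y (q ! ((a + e * k') mod length q))" if a: "a < length q" for a
  proof (rule ccontr)
    define a' where "a' = (a + e * k') mod length q"
    have a': "a' < length q" using a unfolding a'_def by (intro mod_less_divisor) auto
    have in_C: "x (q ! a) \<in> C" "y (q ! a') \<in> C" using x y a a' by auto
    assume "\<not> ?thesis"
    then have lt: "height_in C (y (q ! a')) < height_in C (x (q ! a))"
      using height_in_less[OF C in_C(2)] by (simp add: a'_def)
    \<comment> \<open>Offset \<open>b\<close> holds the first zero after the ones of the block for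
      \<open>y\<close>, but still a one of the larger block for \<open>x\<close>.\<close>
    define b where "b = height_in C (y (q ! a'))"
    have b: "b < nat c" using lt height_le_c[OF in_C(1)] by (simp add: b_def)
    define i where "i = c * int a + int b"
    have "encode C q x i" unfolding i_def using encode_block[OF a b] lt by (simp add: b_def)
    then have e: "encode C q y (i + k * (c * int e))" by (rule k)
    have "i + k * (c * int e) = int b + c * (int a + int e * k)" by (simp add: i_def algebra_simps)
    have d: "(i + k * (c * int e)) mod c = int b" "(i + k * (c * int e)) div c = int a + int e * k"
      unfolding \<open>i + k * (c * int e) = _\<close> using c b by simp_all
    have "int a' = (int a + int e * k) mod n"
      unfolding a'_def by (simp add: zmod_int k' n_def[symmetric]) (metis mod_add_right_eq mod_mult_right_eq)
    then have "nat ((int a + int e * k) mod n) = a'" by (metis nat_int)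
    then show False using e by (simp add: encode_iff d b_def)
  qed
  then show "cycle_le q e x y" unfolding cycle_le_nth[OF q] by blast
qed

lemma has_scd_long_cycle:
  "has_scd (set q \<rightarrow>\<^sub>E C) (cycle_le q e) (\<lambda>x. \<Sum>i\<in>set q. height_in C (x i)) ((card C - 1) * length q)"
proof -
  have cn: "0 < c * n" using c n by simp
  have in_C: "x ` set q \<subseteq> C" if "x \<in> set q \<rightarrow>\<^sub>E C" for x using that by auto
  have scd: "has_scd (words c (c * n)) (rot_le (c * int e)) (weight (c * n)) (nat (c * n))"
    by (rule words_has_scd[OF cn]) simp
  have img: "encode C q ` (set q \<rightarrow>\<^sub>E C) = words c (c * n)"
  proof
    show "encode C q ` (set q \<rightarrow>\<^sub>E C) \<subseteq> words c (c * n)"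
      using encode_periodic encode_block_sorted unfolding words_def by blast
    show "words c (c * n) \<subseteq> encode C q ` (set q \<rightarrow>\<^sub>E C)"
      using encode_surj by blast
  qed
  have N: "nat (c * n) = (card C - 1) * length q"
    unfolding c_def n_def by (simp flip: of_nat_mult)
  show ?thesis
    by (rule has_scd_pullback[OF scd img, unfolded N])
      (simp_all add: encode_le[OF in_C in_C] encode_weight[OF in_C])
qed

end

text \<open>What remains beyond \<open>has_scd_long_cycle\<close> is degenerate: a chain with one
  element has blocks of length 0, an empty cycle has period 0, and in both cases there is only one
  tuple.\<close>

lemma has_scd_cycle:
  assumes C: "finite C" "C \<noteq> {}" and q: "distinct q"
  shows "has_scd (set q \<rightarrow>\<^sub>E C) (cycle_le q e) (\<lambda>x. \<Sum>i\<in>set q. height_in C (x i))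
           ((card C - 1) * length q)"
proof (cases "card C - 1 = 0 \<or> q = []")
  case True
  have "\<exists>a. (set q \<rightarrow>\<^sub>E C) = {a} \<and> (\<Sum>i\<in>set q. height_in C (a i)) = 0"
  proof (cases "q = []")
    case False
    then have "card C = 1" using True C by (metis One_nat_def Suc_pred card_gt_0_iff)
    then obtain v where "C = {v}" by (auto simp: card_1_singleton_iff)
    then show ?thesis by (intro exI[of _ "restrict (\<lambda>_. v) (set q)"]) (auto simp: PiE_singleton height_in_def)
  qed auto
  then obtain a where a: "(set q \<rightarrow>\<^sub>E C) = {a}" "(\<Sum>i\<in>set q. height_in C (a i)) = 0" by blast
  have "cycle_le q e a a" unfolding cycle_le_def by (intro exI[of _ 0]) simp
  moreover have N: "(card C - 1) * length q = 0" using True by auto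
  ultimately show ?thesis unfolding N using a by (intro has_scd_singleton[of _ a])
next
  case False
  then show ?thesis by (intro has_scd_long_cycle[OF C(1) q refl _ refl]) auto
qed

section \<open>Groups generated by powers of disjoint cycles\<close>

lemma cycle_funpow_in: "i \<in> set q \<Longrightarrow> (cycle_of_list q ^^ j) i \<in> set q"
  by (induction j) (simp_all add: permutes_in_image[OF cycle_permutes])

lemma cycle_le_restrict:
  assumes "set q \<subseteq> A"
  shows "cycle_le q e (restrict x A) (restrict y A) \<longleftrightarrow> cycle_le q e x y"
proof -
  have "restrict x A i = x i" "restrict y A ((cycle_of_list q ^^ j) i) = y ((cycle_of_list q ^^ j) i)"
    if "i \<in> set q" for i j
    using that assms cycle_funpow_in[OF that] by auto
  then show ?thesis unfolding cycle_le_def by simp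
qed

text \<open>The comparison is a conjunction over disjoint cycles, so splitting off one cycle turns
  it into a product quasi-order.\<close>

lemma has_scd_cycles:
  assumes C: "finite C" "C \<noteq> {}" and "distinct (concat (map fst qs))"
  shows "has_scd (set (concat (map fst qs)) \<rightarrow>\<^sub>E C) (\<lambda>x y. \<forall>(q, e)\<in>set qs. cycle_le q e x y)
    (\<lambda>x. \<Sum>i\<in>set (concat (map fst qs)). height_in C (x i))
    ((card C - 1) * length (concat (map fst qs)))"
  using assms(3)
proof (induction qs)
  case Nil
  have "has_scd ({} \<rightarrow>\<^sub>E C) (\<lambda>x y. True) (\<lambda>x. 0) 0"
    by (rule has_scd_singleton[of _ "\<lambda>_. undefined"]) auto
  then show ?case by simp
next
  case (Cons p qs)
  obtain q e where p: "p = (q, e)" by fastforce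
  define U where "U = set (concat (map fst qs))"
  have q: "distinct q" "set q \<inter> U = {}" using Cons.prems by (auto simp: p U_def)
  have sub: "set q' \<subseteq> U" if "(q', e') \<in> set qs" for q' e'
    using that by (force simp: U_def)
  define f where "f x = (restrict x (set q), restrict x U)" for x :: "nat \<Rightarrow> 'a"
  have img: "f ` (set q \<union> U \<rightarrow>\<^sub>E C) = (set q \<rightarrow>\<^sub>E C) \<times> (U \<rightarrow>\<^sub>E C)"
  proof
    show "f ` (set q \<union> U \<rightarrow>\<^sub>E C) \<subseteq> (set q \<rightarrow>\<^sub>E C) \<times> (U \<rightarrow>\<^sub>E C)"
      by (auto simp: f_def)
    show "(set q \<rightarrow>\<^sub>E C) \<times> (U \<rightarrow>\<^sub>E C) \<subseteq> f ` (set q \<union> U \<rightarrow>\<^sub>E C)"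
    proof
      fix z assume "z \<in> (set q \<rightarrow>\<^sub>E C) \<times> (U \<rightarrow>\<^sub>E C)"
      then obtain x y where z: "z = (x, y)" "x \<in> set q \<rightarrow>\<^sub>E C" "y \<in> U \<rightarrow>\<^sub>E C" by blast
      define v where "v i = (if i \<in> set q then x i else y i)" for i
      have "restrict v (set q) i = x i" for i
        using PiE_arb[OF z(2), of i] by (simp add: v_def)
      moreover have "restrict v U i = y i" for i
        using PiE_arb[OF z(3), of i] q(2) by (auto simp: v_def)
      ultimately have "restrict v (set q) = x" "restrict v U = y" by blast+
      moreover have "v \<in> set q \<union> U \<rightarrow>\<^sub>E C"
      proof (rule PiE_I)
        fix i assume "i \<in> set q \<union> U"
        then show "v i \<in> C" using PiE_mem[OF z(2), of i] PiE_mem[OF z(3), of i] by (auto simp: v_def)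
      next
        fix i assume "i \<notin> set q \<union> U"
        then show "v i = undefined" using PiE_arb[OF z(3), of i] by (simp add: v_def)
      qed
      ultimately show "z \<in> f ` (set q \<union> U \<rightarrow>\<^sub>E C)" using z(1) by (auto simp: f_def)
    qed
  qed
  have "distinct (concat (map fst qs))" using Cons.prems by simp
  note IH = Cons.IH[OF this, folded U_def]
  have "has_scd (set q \<union> U \<rightarrow>\<^sub>E C) (\<lambda>x y. \<forall>(q, e)\<in>set (p # qs). cycle_le q e x y)
    (\<lambda>x. \<Sum>i\<in>set q \<union> U. height_in C (x i))
    ((card C - 1) * length q + (card C - 1) * length (concat (map fst qs)))"
  proof (rule has_scd_pullback[OF has_scd_prod[OF has_scd_cycle[OF C q(1), of e] IH] img])
    fix x y :: "nat \<Rightarrow> 'a"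
    have "(\<forall>(q, e)\<in>set qs. cycle_le q e (restrict x U) (restrict y U)) \<longleftrightarrow>
        (\<forall>(q, e)\<in>set qs. cycle_le q e x y)"
      using cycle_le_restrict[OF sub] by blast
    then show "(\<forall>(q, e)\<in>set (p # qs). cycle_le q e x y) \<longleftrightarrow>
        (case f x of (x, y) \<Rightarrow> \<lambda>(x', y'). cycle_le q e x x' \<and>
          (\<forall>(q, e)\<in>set qs. cycle_le q e y y')) (f y)"
      by (simp add: f_def p cycle_le_restrict)
    show "(\<Sum>i\<in>set q \<union> U. height_in C (x i)) =
        (case f x of (x, y) \<Rightarrow> (\<Sum>i\<in>set q. height_in C (x i)) + (\<Sum>i\<in>U. height_in C (y i)))"
      using q(2) by (simp add: f_def sum.union_disjoint U_def)
  qed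
  then show ?case by (simp add: p U_def distrib_left)
qed

section \<open>Closure properties of a generated group of bijections\<close>

context
  fixes gs :: "('c \<Rightarrow> 'c) set"
  assumes bij: "\<And>s. s \<in> gs \<Longrightarrow> bij s"
begin

lemma gen_perm_group_bij: "g \<in> gen_perm_group gs \<Longrightarrow> bij g"
proof (induction rule: gen_perm_group.induct)
  case gen_id
  show ?case by (rule bij_id)
next
  case (gen_mult s g)
  then show ?case using bij_comp bij by blast
next
  case (gen_inv s g)
  then show ?case using bij_comp bij_imp_bij_inv bij by blast
qed

lemma gen_perm_group_comp:
  "g \<in> gen_perm_group gs \<Longrightarrow> h \<in> gen_perm_group gs \<Longrightarrow> g \<circ> h \<in> gen_perm_group gs"
  by (induction rule: gen_perm_group.induct) (auto simp: comp_assoc intro: gen_perm_group.intros)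

lemma gen_perm_group_inv: "g \<in> gen_perm_group gs \<Longrightarrow> inv g \<in> gen_perm_group gs"
proof (induction rule: gen_perm_group.induct)
  case gen_id
  show ?case unfolding inv_id by (rule gen_perm_group.gen_id)
next
  case (gen_mult s g)
  have "inv s \<in> gen_perm_group gs"
    using gen_perm_group.gen_inv[OF gen_mult(1) gen_perm_group.gen_id] by simp
  then show ?case
    unfolding o_inv_distrib[OF bij[OF gen_mult(1)] gen_perm_group_bij[OF gen_mult(2)]]
    by (rule gen_perm_group_comp[OF gen_mult(3)])
next
  case (gen_inv s g)
  have "s \<in> gen_perm_group gs"
    using gen_perm_group.gen_mult[OF gen_inv(1) gen_perm_group.gen_id] by simp
  then show ?case
    unfolding o_inv_distrib[OF bij_imp_bij_inv[OF bij[OF gen_inv(1)]] gen_perm_group_bij[OF gen_inv(2)]]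
      inv_inv_eq[OF bij[OF gen_inv(1)]]
    by (rule gen_perm_group_comp[OF gen_inv(3)])
qed

lemma gen_perm_group_funpow: "s \<in> gs \<Longrightarrow> s ^^ k \<in> gen_perm_group gs"
  by (induction k) (auto intro: gen_perm_group.intros)

end

lemma distinct_concat_nth:
  assumes "\<And>j. j < length xss \<Longrightarrow> distinct (xss ! j)"
    and "\<And>j k. j < length xss \<Longrightarrow> k < length xss \<Longrightarrow> j \<noteq> k \<Longrightarrow> set (xss ! j) \<inter> set (xss ! k) = {}"
  shows "distinct (concat xss)"
  using assms
proof (induction xss)
  case (Cons xs xss)
  have "distinct (concat xss)"
    using Cons.prems(1)[of "Suc j" for j] Cons.prems(2)[of "Suc j" "Suc k" for j k]
    by (intro Cons.IH) auto
  moreover have "set xs \<inter> set ys = {}" if "ys \<in> set xss" for ys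
    using that Cons.prems(2)[of 0 "Suc k" for k] by (fastforce simp: in_set_conv_nth)
  ultimately show ?case using Cons.prems(1)[of 0] by auto
qed simp

section \<open>The group as a direct product over the cycles\<close>

lemma cycle_power_permutes:
  fixes q :: "nat list"
  shows "(cycle_of_list q ^^ k) permutes set q"
proof (induction k)
  case 0
  show ?case unfolding funpow.simps(1) by (rule permutes_id)
next
  case (Suc k)
  show ?case unfolding funpow.simps(2) by (rule permutes_compose[OF Suc cycle_permutes])
qed

context
  fixes m :: nat and cs :: "nat list list" and es :: "nat list"
  assumes len: "length es = length cs"
    and cyc: "\<And>j. j < length cs \<Longrightarrow> distinct (cs ! j) \<and> set (cs ! j) \<subseteq> {0..<m}"
    and disj: "\<And>j k. j < length cs \<Longrightarrow> k < length cs \<Longrightarrow> j \<noteq> k \<Longrightarrow> set (cs ! j) \<inter> set (cs ! k) = {}"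
begin

abbreviation (input) "\<sigma> j \<equiv> cycle_of_list (cs ! j)"
abbreviation (input) "cycle_gens \<equiv> {\<sigma> j ^^ (es ! j) | j. j < length cs}"
abbreviation (input) "cycle_group \<equiv> gen_perm_group cycle_gens"

lemma cycle_gens_bij: "s \<in> cycle_gens \<Longrightarrow> bij s"
  using cycle_power_permutes permutes_bij by blast

lemma cycle_power_outside:
  "\<lbrakk>j < length cs; l < length cs; j \<noteq> l; i \<in> set (cs ! j)\<rbrakk> \<Longrightarrow> (\<sigma> l ^^ k) i = i"
  using disj[of j l] permutes_not_in[OF cycle_power_permutes] by blast

text \<open>The exponents add up to a multiple of the length of the cycle. Since the inverse keeps
  the factor \<open>k\<close>, inverse generators are again natural powers of the
  generators.\<close>

lemma inv_cycle_power:
  assumes "j < length cs"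
  shows "inv (\<sigma> j ^^ k) = \<sigma> j ^^ (k * (length (cs ! j) - 1))"
proof (cases "cs ! j = []")
  case True
  then show ?thesis by simp
next
  case False
  have e: "k + k * (length (cs ! j) - 1) = length (cs ! j) * k"
    using False by (cases "length (cs ! j)") (auto simp: algebra_simps)
  have root: "\<sigma> j ^^ length (cs ! j) = id" using cycle_is_id_root cyc[OF assms] by blast
  have "(\<sigma> j ^^ length (cs ! j)) ^^ k = id" unfolding root by (induction k) simp_all
  then have "\<sigma> j ^^ (k + k * (length (cs ! j) - 1)) = id" unfolding e funpow_mult .
  then show ?thesis by (intro inv_unique_comp) (simp_all only: add.commute flip: funpow_add)
qed

lemma cycle_group_permutes: "\<phi> \<in> cycle_group \<Longrightarrow> \<phi> permutes {0..<m}"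
proof (induction rule: gen_perm_group.induct)
  case gen_id
  then show ?case by (rule permutes_id)
next
  case (gen_mult s g)
  then have "s permutes {0..<m}" using permutes_subset[OF cycle_power_permutes] cyc by blast
  then show ?case using gen_mult permutes_compose by blast
next
  case (gen_inv s g)
  then have "s permutes {0..<m}" using permutes_subset[OF cycle_power_permutes] cyc by blast
  then show ?case using gen_inv permutes_compose permutes_inv by blast
qed

lemma cycle_group_acts:
  assumes "\<phi> \<in> cycle_group"
  shows "(\<forall>j<length cs. \<exists>k. \<forall>i\<in>set (cs ! j). \<phi> i = (\<sigma> j ^^ (es ! j * k)) i) \<and>
    (\<forall>i. i \<notin> set (concat cs) \<longrightarrow> \<phi> i = i)"
  using assms
proof (induction rule: gen_perm_group.induct)
  case gen_id
  show ?case by (auto intro!: exI[of _ 0])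
next
  \<comment> \<open>\<open>r = 1\<close> gives a generator, and
    \<open>r = length (cs ! l) - 1\<close> its inverse.\<close>
  have step: "(\<forall>j<length cs. \<exists>k. \<forall>i\<in>set (cs ! j). ((\<sigma> l ^^ (es ! l * r)) \<circ> g) i = (\<sigma> j ^^ (es ! j * k)) i) \<and>
    (\<forall>i. i \<notin> set (concat cs) \<longrightarrow> ((\<sigma> l ^^ (es ! l * r)) \<circ> g) i = i)"
    if l: "l < length cs" and IH: "(\<forall>j<length cs. \<exists>k. \<forall>i\<in>set (cs ! j). g i = (\<sigma> j ^^ (es ! j * k)) i) \<and>
      (\<forall>i. i \<notin> set (concat cs) \<longrightarrow> g i = i)" for l r g
  proof (intro conjI allI impI)
    fix j assume j: "j < length cs"
    then obtain k where k: "\<And>i. i \<in> set (cs ! j) \<Longrightarrow> g i = (\<sigma> j ^^ (es ! j * k)) i" using IH by blast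
    show "\<exists>k. \<forall>i\<in>set (cs ! j). ((\<sigma> l ^^ (es ! l * r)) \<circ> g) i = (\<sigma> j ^^ (es ! j * k)) i"
    proof (cases "j = l")
      case True
      then show ?thesis using k
        by (intro exI[of _ "r + k"]) (simp add: distrib_left funpow_add)
    next
      case False
      have "((\<sigma> l ^^ (es ! l * r)) \<circ> g) i = (\<sigma> j ^^ (es ! j * k)) i" if "i \<in> set (cs ! j)" for i
        using k[OF that] cycle_power_outside[OF j l False cycle_funpow_in[OF that]] by simp
      then show ?thesis by blast
    qed
  next
    fix i assume i: "i \<notin> set (concat cs)"
    then have "i \<notin> set (cs ! l)" using l by auto
    then show "((\<sigma> l ^^ (es ! l * r)) \<circ> g) i = i"
      using IH i permutes_not_in[OF cycle_power_permutes] by simp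
  qed
  {
    case (gen_mult s g)
    then obtain l where l: "l < length cs" "s = \<sigma> l ^^ (es ! l)" by blast
    show ?case by (rule step[OF l(1) gen_mult.IH, of 1, unfolded mult_1_right, folded l(2)])
  next
    case (gen_inv s g)
    then obtain l where l: "l < length cs" "s = \<sigma> l ^^ (es ! l)" by blast
    show ?case unfolding l(2) inv_cycle_power[OF l(1)] by (rule step[OF l(1) gen_inv.IH])
  }
qed

text \<open>Each generator fixes the other cycles, so the exponents \<open>k j\<close> can be
  realised one cycle at a time; \<open>n\<close> counts the cycles already treated. It follows that
  a single group element can witness all the relations \<open>cycle_le\<close> at once.\<close>

lemma cycle_group_ex:
  shows "\<exists>\<phi>\<in>cycle_group. (\<forall>j<length cs. \<forall>i\<in>set (cs ! j). \<phi> i = (\<sigma> j ^^ (es ! j * k j)) i) \<and>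
    (\<forall>i. i \<notin> set (concat cs) \<longrightarrow> \<phi> i = i)"
proof -
  have "\<exists>\<phi>\<in>cycle_group. (\<forall>j<length cs. \<forall>i\<in>set (cs ! j).
      \<phi> i = (if j < n then (\<sigma> j ^^ (es ! j * k j)) i else i)) \<and> (\<forall>i. i \<notin> set (concat cs) \<longrightarrow> \<phi> i = i)"
    if "n \<le> length cs" for n
    using that
  proof (induction n)
    case 0
    show ?case by (intro bexI[OF _ gen_perm_group.gen_id]) simp
  next
    case (Suc n)
    then have "n \<le> length cs" by simp
    from Suc.IH[OF this] obtain \<phi> where \<phi>: "\<phi> \<in> cycle_group" "\<And>j i. j < length cs \<Longrightarrow> i \<in> set (cs ! j) \<Longrightarrow>
        \<phi> i = (if j < n then (\<sigma> j ^^ (es ! j * k j)) i else i)" "\<And>i. i \<notin> set (concat cs) \<Longrightarrow> \<phi> i = i"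
      by blast
    have n: "n < length cs" using Suc.prems by simp
    define s where "s = \<sigma> n ^^ (es ! n * k n)"
    have gen: "\<sigma> n ^^ (es ! n) \<in> cycle_gens" using n by blast
    have "(\<sigma> n ^^ (es ! n)) ^^ k n \<in> cycle_group"
      by (rule gen_perm_group_funpow[OF cycle_gens_bij gen])
    then have "s \<in> cycle_group" by (simp add: s_def funpow_mult mult.commute)
    then have "s \<circ> \<phi> \<in> cycle_group" using gen_perm_group_comp[OF cycle_gens_bij] \<phi>(1) by blast
    moreover have "(s \<circ> \<phi>) i = (if j < Suc n then (\<sigma> j ^^ (es ! j * k j)) i else i)"
      if "j < length cs" "i \<in> set (cs ! j)" for j i
    proof (cases "j = n")
      case True
      then show ?thesis using \<phi>(2)[OF that] by (simp add: s_def)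
    next
      case False
      have "\<phi> i \<in> set (cs ! j)" using \<phi>(2)[OF that] that(2) cycle_funpow_in[OF that(2)] by simp
      then have "s (\<phi> i) = \<phi> i" unfolding s_def using cycle_power_outside[OF that(1) n False] by blast
      then show ?thesis using \<phi>(2)[OF that] False by simp
    qed
    moreover have "(s \<circ> \<phi>) i = i" if "i \<notin> set (concat cs)" for i
    proof -
      have "i \<notin> set (cs ! n)" using that n by auto
      then show ?thesis
        using \<phi>(3)[OF that] permutes_not_in[OF cycle_power_permutes] by (simp add: s_def)
    qed
    ultimately show ?case by blast
  qed
  from this[of "length cs"] show ?thesis by auto
qed

lemma cycle_group_le_iff:
  "(\<exists>\<phi>\<in>cycle_group. \<forall>i<m. x i \<le> y (\<phi> i)) \<longleftrightarrow>
    (\<forall>j<length cs. cycle_le (cs ! j) (es ! j) x y) \<and> (\<forall>i<m. i \<notin> set (concat cs) \<longrightarrow> x i \<le> y i)"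
proof
  assume "\<exists>\<phi>\<in>cycle_group. \<forall>i<m. x i \<le> y (\<phi> i)"
  then obtain \<phi> where \<phi>: "\<phi> \<in> cycle_group" "\<And>i. i < m \<Longrightarrow> x i \<le> y (\<phi> i)" by blast
  note acts = cycle_group_acts[OF \<phi>(1)]
  have "cycle_le (cs ! j) (es ! j) x y" if j: "j < length cs" for j
  proof -
    obtain k where k: "\<And>i. i \<in> set (cs ! j) \<Longrightarrow> \<phi> i = (\<sigma> j ^^ (es ! j * k)) i"
      using acts j by blast
    have "x i \<le> y ((\<sigma> j ^^ (es ! j * k)) i)" if "i \<in> set (cs ! j)" for i
      using \<phi>(2)[of i] k[OF that] cyc[OF j] that by auto
    then show ?thesis unfolding cycle_le_def by blast
  qed
  moreover have "x i \<le> y i" if "i < m" "i \<notin> set (concat cs)" for i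
    using \<phi>(2)[OF that(1)] acts that(2) by simp
  ultimately show "(\<forall>j<length cs. cycle_le (cs ! j) (es ! j) x y) \<and>
      (\<forall>i<m. i \<notin> set (concat cs) \<longrightarrow> x i \<le> y i)" by blast
next
  assume R: "(\<forall>j<length cs. cycle_le (cs ! j) (es ! j) x y) \<and>
      (\<forall>i<m. i \<notin> set (concat cs) \<longrightarrow> x i \<le> y i)"
  then have "\<forall>j. \<exists>k. j < length cs \<longrightarrow> (\<forall>i\<in>set (cs ! j). x i \<le> y ((\<sigma> j ^^ (es ! j * k)) i))"
    unfolding cycle_le_def by blast
  then obtain k where k: "\<And>j i. j < length cs \<Longrightarrow> i \<in> set (cs ! j) \<Longrightarrow>
      x i \<le> y ((\<sigma> j ^^ (es ! j * k j)) i)"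
    by metis
  obtain \<phi> where \<phi>: "\<phi> \<in> cycle_group"
      "\<And>j i. j < length cs \<Longrightarrow> i \<in> set (cs ! j) \<Longrightarrow> \<phi> i = (\<sigma> j ^^ (es ! j * k j)) i"
      "\<And>i. i \<notin> set (concat cs) \<Longrightarrow> \<phi> i = i"
    using cycle_group_ex[of k] by blast
  have "x i \<le> y (\<phi> i)" if "i < m" for i
  proof (cases "i \<in> set (concat cs)")
    case True
    then obtain q where "q \<in> set cs" "i \<in> set q" by auto
    then obtain j where "j < length cs" "i \<in> set (cs ! j)" by (metis in_set_conv_nth)
    then show ?thesis using k \<phi>(2) by simp
  next
    case False
    then show ?thesis using R that \<phi>(3) by simp
  qed
  then show "\<exists>\<phi>\<in>cycle_group. \<forall>i<m. x i \<le> y (\<phi> i)" using \<phi>(1) by blast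
qed

lemma has_scd_cube:
  assumes C: "finite C" "C \<noteq> {}"
  shows "has_scd (cube C m) (\<lambda>x y. \<exists>\<phi>\<in>cycle_group. \<forall>i<m. x i \<le> y (\<phi> i))
    (\<lambda>x. \<Sum>i<m. height_in C (x i)) ((card C - 1) * m)"
proof -
  define fs where "fs = filter (\<lambda>i. i \<notin> set (concat cs)) [0..<m]"
  \<comment> \<open>Coordinates outside all cycles become cycles of length one with exponent 0, so
    that the list covers all of \<open>{..<m}\<close>.\<close>
  define qs where "qs = zip cs es @ map (\<lambda>i. ([i], 0)) fs"
  have concat: "concat (map fst qs) = concat cs @ fs"
    by (simp add: qs_def len comp_def)
  have "set cs' \<subseteq> {0..<m}" if "cs' \<in> set cs" for cs'
    using that cyc by (metis in_set_conv_nth)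
  then have set: "set (concat (map fst qs)) = {..<m}"
    unfolding concat by (fastforce simp: fs_def)
  have dist: "distinct (concat (map fst qs))"
    unfolding concat using distinct_concat_nth[of cs] cyc disj by (auto simp: fs_def)
  have "length (concat (map fst qs)) = m"
    using distinct_card[OF dist] set by simp
  moreover have "(\<forall>(q, e)\<in>set qs. cycle_le q e x y) \<longleftrightarrow> (\<exists>\<phi>\<in>cycle_group. \<forall>i<m. x i \<le> y (\<phi> i))"
    for x y :: "nat \<Rightarrow> 'a"
  proof -
    have "(\<forall>(q, e)\<in>set (zip cs es). cycle_le q e x y) \<longleftrightarrow>
        (\<forall>j<length cs. cycle_le (cs ! j) (es ! j) x y)"
      by (auto simp: set_zip len)
    moreover have "(\<forall>(q, e)\<in>set (map (\<lambda>i. ([i], 0)) fs). cycle_le q e x y) \<longleftrightarrow>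
        (\<forall>i<m. i \<notin> set (concat cs) \<longrightarrow> x i \<le> y i)"
      by (auto simp: fs_def cycle_le_def)
    ultimately show ?thesis unfolding cycle_group_le_iff qs_def set_append ball_Un by blast
  qed
  ultimately show ?thesis
    using has_scd_cycles[OF C dist] unfolding set cube_def by (simp add: atLeast0LessThan)
qed

end

section \<open>From tuples to orbits\<close>

lemma sum_height_eq_imp_eq:
  fixes x y :: "nat \<Rightarrow> 'a::linorder"
  assumes C: "finite C" and x: "\<And>i. i < m \<Longrightarrow> x i \<in> C" and y: "\<And>i. i < m \<Longrightarrow> y i \<in> C"
    and le: "\<And>i. i < m \<Longrightarrow> x i \<le> y i"
    and eq: "(\<Sum>i<m. height_in C (x i)) = (\<Sum>i<m. height_in C (y i))" and i: "i < m"
  shows "x i = y i"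
proof -
  have "height_in C (x i) = height_in C (y i)"
  proof (rule sum_mono_inv[OF eq])
    show "height_in C (x j) \<le> height_in C (y j)" if "j \<in> {..<m}" for j
      using that height_in_le_iff[OF C x y] le by simp
  qed (use i in auto)
  then show ?thesis using height_in_le_iff[OF C y[OF i] x[OF i]] le[OF i] by simp
qed

theorem theorem2p6:
  fixes C :: "'a::linorder set" and m :: nat
    and cs :: "nat list list" and es :: "nat list"
  assumes "finite C" and "C \<noteq> {}" and "m \<ge> 1"
    and "length es = length cs"
    and "\<forall>j<length cs. distinct (cs ! j) \<and> set (cs ! j) \<subseteq> {0..<m}"
    and "\<forall>j<length cs. \<forall>k<length cs. j \<noteq> k \<longrightarrow> set (cs ! j) \<inter> set (cs ! k) = {}"
  shows "symmetric_chain_order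
           (quotient_cube C m
              (gen_perm_group {cycle_of_list (cs ! j) ^^ (es ! j) | j. j < length cs}))
           (quotient_le m)"
proof -
  define S where "S = {cycle_of_list (cs ! j) ^^ (es ! j) | j. j < length cs}"
  define K where "K = gen_perm_group S"
  note C = assms(1,2)
  have cyc: "j < length cs \<Longrightarrow> distinct (cs ! j) \<and> set (cs ! j) \<subseteq> {0..<m}" for j
    using assms(5) by blast
  have disj: "j < length cs \<Longrightarrow> k < length cs \<Longrightarrow> j \<noteq> k \<Longrightarrow> set (cs ! j) \<inter> set (cs ! k) = {}" for j k
    using assms(6) by blast
  have bij: "bij s" if "s \<in> S" for s
    using that permutes_bij[OF cycle_power_permutes] by (auto simp: S_def)
  have K_id: "id \<in> K" unfolding K_def by (rule gen_perm_group.gen_id)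
  have K_comp: "g \<circ> h \<in> K" if "g \<in> K" "h \<in> K" for g h
    using gen_perm_group_comp[OF bij] that unfolding K_def by blast
  have K_inv: "inv g \<in> K" if "g \<in> K" for g
    using gen_perm_group_inv[OF bij] that unfolding K_def by blast
  have K_perm: "g permutes {0..<m}" if "g \<in> K" for g
    using cycle_group_permutes[OF assms(4) cyc disj, of g] that unfolding K_def S_def by blast
  have K_lt: "g i < m" if "g \<in> K" "i < m" for g i
    using permutes_in_image[OF K_perm[OF that(1)], of i] that(2) by simp
  \<comment> \<open>The quotient order pulled back to tuples; the two group elements in a comparison
    of orbits are combined into one.\<close>
  define le where "le x y \<longleftrightarrow> (\<exists>\<phi>\<in>K. \<forall>i<m. x i \<le> y (\<phi> i))" for x y :: "nat \<Rightarrow> 'a"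
  define r where "r x = (\<Sum>i<m. height_in C (x i))" for x :: "nat \<Rightarrow> 'a"
  have r_perm: "(\<Sum>i<m. height_in C (y (\<phi> i))) = r y" if "\<phi> \<in> K" for y \<phi>
    using sum.permute[OF K_perm[OF that], of "\<lambda>i. height_in C (y i)"]
    by (simp add: r_def atLeast0LessThan comp_def)
  have cube_in: "x i \<in> C" if "x \<in> cube C m" "i < m" for x i
    using that by (auto simp: cube_def)
  have act_comp: "perm_act m h (perm_act m g y) = perm_act m (h \<circ> g) y" if "g \<in> K" "h \<in> K" for g h y
  proof
    fix i
    have "inv (h \<circ> g) i = inv g (inv h i)"
      using o_inv_distrib[OF permutes_bij[OF K_perm[OF that(2)]] permutes_bij[OF K_perm[OF that(1)]]] by simp
    then show "perm_act m h (perm_act m g y) i = perm_act m (h \<circ> g) y i"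
      using K_lt[OF K_inv[OF that(2)], of i] by (simp add: perm_act_def restrict_def)
  qed
  have scd: "has_scd (cube C m) le r ((card C - 1) * m)"
    using has_scd_cube[OF assms(4) cyc disj C] unfolding le_def r_def K_def S_def by blast
  have "symmetric_chain_order (orbit_of m K ` cube C m) (quotient_le m)"
  proof (rule symmetric_chain_order_quotientI[OF scd])
    show "finite (cube C m)" unfolding cube_def using C(1) by (intro finite_PiE) auto
    fix x y :: "nat \<Rightarrow> 'a" assume x: "x \<in> cube C m" and y: "y \<in> cube C m"
    show "quotient_le m (orbit_of m K x) (orbit_of m K y) \<longleftrightarrow> le x y"
    proof
      assume "quotient_le m (orbit_of m K x) (orbit_of m K y)"
      then obtain g h where gh: "g \<in> K" "h \<in> K" "\<And>i. i < m \<Longrightarrow> x (inv g i) \<le> y (inv h i)"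
        by (auto simp: quotient_le_def orbit_of_def perm_act_def)
      have "x i \<le> y ((inv h \<circ> g) i)" if "i < m" for i
        using gh(3)[OF K_lt[OF gh(1) that]] permutes_inverses(2)[OF K_perm[OF gh(1)]] by simp
      then show "le x y" unfolding le_def using K_comp[OF K_inv[OF gh(2)] gh(1)] by blast
    next
      assume "le x y"
      then obtain g where g: "g \<in> K" "\<And>i. i < m \<Longrightarrow> x i \<le> y (g i)" unfolding le_def by blast
      have "inv (inv g) = g" using inv_inv_eq[OF permutes_bij[OF K_perm[OF g(1)]]] .
      then have "\<forall>i<m. perm_act m id x i \<le> perm_act m (inv g) y i"
        using g(2) by (simp add: perm_act_def)
      then show "quotient_le m (orbit_of m K x) (orbit_of m K y)"
        unfolding quotient_le_def orbit_of_def using K_id K_inv[OF g(1)] by blast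
    qed
    show "r x \<le> r y" if "le x y"
    proof -
      obtain g where g: "g \<in> K" "\<And>i. i < m \<Longrightarrow> x i \<le> y (g i)" using \<open>le x y\<close> unfolding le_def by blast
      have "r x \<le> (\<Sum>i<m. height_in C (y (g i)))"
        unfolding r_def
      proof (rule sum_mono)
        fix i assume "i \<in> {..<m}"
        then have "i < m" by simp
        then show "height_in C (x i) \<le> height_in C (y (g i))"
          using height_in_le_iff[OF C(1) cube_in[OF x] cube_in[OF y K_lt[OF g(1)]]] g(2) by blast
      qed
      then show ?thesis using r_perm[OF g(1)] by simp
    qed
    show "orbit_of m K x = orbit_of m K y" if "le x y" "r x = r y"
    proof -
      obtain g where g: "g \<in> K" "\<And>i. i < m \<Longrightarrow> x i \<le> y (g i)" using \<open>le x y\<close> unfolding le_def by blast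
      have eq: "x i = y (g i)" if "i < m" for i
        using C(1) cube_in[OF x] cube_in[OF y K_lt[OF g(1)]] g(2) _ that
      proof (rule sum_height_eq_imp_eq)
        show "(\<Sum>i<m. height_in C (x i)) = (\<Sum>i<m. height_in C (y (g i)))"
          using r_perm[OF g(1)] \<open>r x = r y\<close> by (simp add: r_def)
      qed
      \<comment> \<open>\<open>perm_act\<close> composes with the inverse, so it is the inverse of
        \<open>g\<close> that carries \<open>y\<close> to \<open>x\<close>.\<close>
      define h where "h = inv g"
      have h: "h \<in> K" "inv h = g"
        using K_inv[OF g(1)] inv_inv_eq[OF permutes_bij[OF K_perm[OF g(1)]]] by (auto simp: h_def)
      have "x = perm_act m h y"
      proof
        fix i
        show "x i = perm_act m h y i"
          using eq[of i] x h(2) by (cases "i < m") (auto simp: perm_act_def cube_def)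
      qed
      then have "orbit_of m K x = (\<lambda>\<phi>. perm_act m (\<phi> \<circ> h) y) ` K"
        unfolding orbit_of_def using act_comp[OF h(1)] by auto
      also have "\<dots> = orbit_of m K y"
        unfolding orbit_of_def
      proof
        show "(\<lambda>\<phi>. perm_act m (\<phi> \<circ> h) y) ` K \<subseteq> (\<lambda>\<phi>. perm_act m \<phi> y) ` K"
          using K_comp[OF _ h(1)] by blast
        show "(\<lambda>\<phi>. perm_act m \<phi> y) ` K \<subseteq> (\<lambda>\<phi>. perm_act m (\<phi> \<circ> h) y) ` K"
        proof
          fix z assume "z \<in> (\<lambda>\<phi>. perm_act m \<phi> y) ` K"
          then obtain \<phi> where \<phi>: "\<phi> \<in> K" "z = perm_act m \<phi> y" by blast
          have "(\<phi> \<circ> g) \<circ> h = \<phi>"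
            unfolding h_def comp_assoc permutes_inv_o(1)[OF K_perm[OF g(1)]] by simp
          then show "z \<in> (\<lambda>\<phi>. perm_act m (\<phi> \<circ> h) y) ` K"
            using \<phi> K_comp[OF \<phi>(1) g(1)] by (intro image_eqI[of _ _ "\<phi> \<circ> g"]) auto
        qed
      qed
      finally show ?thesis .
    qed
    show "\<exists>z\<in>cube C m. le x z \<and> le z y \<and> r z = Suc (r x)" if "le x y" "r x < r y"
    proof -
      obtain g where g: "g \<in> K" "\<And>i. i < m \<Longrightarrow> x i \<le> y (g i)" using \<open>le x y\<close> unfolding le_def by blast
      have "\<exists>i<m. height_in C (x i) < height_in C (y (g i))"
      proof (rule ccontr)
        assume "\<not> ?thesis"
        then have "(\<Sum>i<m. height_in C (y (g i))) \<le> r x"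
          unfolding r_def by (intro sum_mono) (meson lessThan_iff not_le)
        then show False using r_perm[OF g(1)] \<open>r x < r y\<close> by simp
      qed
      then obtain i where i: "i < m" "height_in C (x i) < height_in C (y (g i))" by blast
      have img: "height_in C ` C = {..<card C}"
        using bij_betw_height_in[OF C(1)] by (simp add: bij_betw_def)
      have yC: "y (g i) \<in> C" using cube_in[OF y K_lt[OF g(1) i(1)]] .
      then have "height_in C (y (g i)) < card C" using img by blast
      then have "Suc (height_in C (x i)) \<in> height_in C ` C" unfolding img using i(2) by simp
      then obtain v where v: "v \<in> C" "height_in C v = Suc (height_in C (x i))" by (metis imageE)
      \<comment> \<open>One coordinate is raised by one step of the chain. It was strictly below its
        partner in \<open>y\<close>, so \<open>z\<close> is still below \<open>y\<close> with the
        same \<open>g\<close>.\<close>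
      define z where "z = x(i := v)"
      have "z \<in> cube C m" using x v(1) i(1) by (auto simp: z_def cube_def PiE_iff extensional_def)
      moreover have xv: "x i \<le> v" using height_in_le_iff[OF C(1) cube_in[OF x i(1)] v(1)] v(2) by simp
      have "le x z" unfolding le_def
        by (rule bexI[OF _ K_id]) (use xv in \<open>simp add: z_def\<close>)
      moreover have vy: "v \<le> y (g i)" using height_in_le_iff[OF C(1) v(1) yC] v(2) i(2) by simp
      have "le z y" unfolding le_def
        by (rule bexI[OF _ g(1)]) (use vy g(2) in \<open>simp add: z_def\<close>)
      moreover have "r z = Suc (r x)"
      proof -
        have "(\<Sum>j\<in>{..<m} - {i}. height_in C (z j)) = (\<Sum>j\<in>{..<m} - {i}. height_in C (x j))"
          by (rule sum.cong) (auto simp: z_def)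
        then show ?thesis
          using sum.remove[of "{..<m}" i "\<lambda>j. height_in C (z j)"]
            sum.remove[of "{..<m}" i "\<lambda>j. height_in C (x j)"] i(1) v(2)
          by (simp add: r_def z_def)
      qed
      ultimately show ?thesis by blast
    qed
  next
    show "le x x" for x unfolding le_def by (rule bexI[OF _ K_id]) simp
  next
    fix x y z :: "nat \<Rightarrow> 'a" assume "le x y" "le y z"
    then obtain g h where gh: "g \<in> K" "h \<in> K" "\<And>i. i < m \<Longrightarrow> x i \<le> y (g i)" "\<And>i. i < m \<Longrightarrow> y i \<le> z (h i)"
      unfolding le_def by blast
    have "x i \<le> z ((h \<circ> g) i)" if "i < m" for i
      using gh(3)[OF that] gh(4)[OF K_lt[OF gh(1) that]] by simp
    then show "le x z" unfolding le_def using K_comp[OF gh(2,1)] by blast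
  next
    define b where "b = restrict (\<lambda>_. Min C) {0..<m}"
    have Min: "Min C \<in> C" "\<And>c. c \<in> C \<Longrightarrow> Min C \<le> c" using C by auto
    show "b \<in> cube C m" using Min(1) by (auto simp: b_def cube_def)
    have "{c \<in> C. c < Min C} = {}" using Min(2) by (auto simp: not_less)
    then have "height_in C (Min C) = 0" by (simp only: height_in_def card.empty)
    then show "r b = 0" by (simp add: r_def b_def)
    fix x assume "x \<in> cube C m"
    then show "le b x" unfolding le_def
      by (intro bexI[OF _ K_id]) (simp add: b_def Min(2) cube_in)
  qed
  then show ?thesis unfolding quotient_cube_def K_def S_def .
qed

end
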